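(* Suppose $s>0$ and $\mu$ is a finite Borel measure on $[0,1]$ for which there is a constant $K$ such that $$\mu([0,r])\leq K r^{s/2}\quad\forall r>0,$$ and $$\mu([x,x+r])\leq K\min\{1,x^{-s/2}r^s\}\quad\forall x\in\operatorname{supp}\mu\setminus\{0\},\ \forall r>0.$$ Let $\omega(t)$, $t\ge 0$, be the standard one-dimensional Brownian motion with $\omega(0)=0$, and let $\mu_\omega:=\omega_*\mu$ be the push-forward of $\mu$ under $t\mapsto\omega(t)$. Then almost surely there is a finite constant $C(\omega,s)$ (with $\mu$ fixed) such that $$|\widehat{\mu_\omega}(\xi)|\leq C(\omega,s)\,|\xi|^{-s}\log|\xi|\quad\text{for all }|\xi|\geq 2.$$
   Context: $\widehat{\mu_\omega}(\xi)=\int e^{-2\pi i x\xi}\,d\mu_\omega(x)=\int e^{-2\pi i\omega(t)\xi}\,d\mu(t)$. *)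

theory Defs
  imports "HOL-Probability.Probability"
begin

text \<open>
  The space of the measure may be a proper subset of the ambient type, so that \<open>U \<inter> space \<mu>\<close>
  ranges over the relatively open sets.
\<close>

definition measure_support :: "'a::topological_space measure \<Rightarrow> 'a set" where
  "measure_support \<mu> =
     {x \<in> space \<mu>. \<forall>U. open U \<longrightarrow> x \<in> U \<longrightarrow> emeasure \<mu> (U \<inter> space \<mu>) > 0}"

text \<open>
  The normalisation of the exponent differs from that of \<^const>\<open>char\<close>.
\<close>

definition fourier_transform :: "real measure \<Rightarrow> real \<Rightarrow> complex" where
  "fourier_transform \<nu> \<xi> =
     (CLINT x|\<nu>. exp (- 2 * complex_of_real pi * \<i> * complex_of_real x * complex_of_real \<xi>))"

text \<open>
  Only the times \<open>t \<ge> 0\<close> are constrained; the values of \<open>W\<close> at negative times are irrelevant.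
  The start at the origin and the continuity of paths are required almost surely, which covers
  the versions of the definition that ask for them at every sample point.
\<close>

locale brownian_motion = prob_space M
  for M :: "'w measure" +
  fixes W :: "real \<Rightarrow> 'w \<Rightarrow> real"
  assumes random_variable: "t \<ge> 0 \<Longrightarrow> W t \<in> borel_measurable M"
    and start_zero: "AE \<omega> in M. W 0 \<omega> = 0"
    and indep_increments:
      "\<lbrakk>0 \<le> \<tau> 0; \<And>i. i < n \<Longrightarrow> \<tau> i < \<tau> (Suc i)\<rbrakk> \<Longrightarrow>
         indep_vars (\<lambda>_. borel) (\<lambda>i \<omega>. W (\<tau> (Suc i)) \<omega> - W (\<tau> i) \<omega>) {..<n::nat}"
    and normal_increments:
      "\<lbrakk>0 \<le> a; a < b\<rbrakk> \<Longrightarrow>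
         distributed M lborel (\<lambda>\<omega>. W b \<omega> - W a \<omega>) (normal_density 0 (sqrt (b - a)))"
    and continuous_paths: "AE \<omega> in M. continuous_on {0..} (\<lambda>t. W t \<omega>)"

end

theory Submission
  imports Defs
begin

text \<open>
  At frequency \<open>R\<close> the times \<open>t \<le> 1 / R^2\<close> carry mass at most \<open>K / R^s\<close> and may be dropped. For the
  remaining times the transform is discretised on the grid \<open>j / n\<close>, with cell masses \<open>m\<^sub>j\<close>. The
  phases of the Brownian increments are independent with mean \<open>\<rho> = exp (- 2 * pi^2 * R^2 / n)\<close>, and
  taking conditional expectations one increment at a time replaces the future of the sum by the
  discounted tail mass, defined by \<open>\<beta>\<^sub>j = m\<^sub>j + \<rho> * \<beta>\<^sub>j\<^sub>+\<^sub>1\<close>. Each step costs a variance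
  \<open>(1 - \<rho>^2) * \<beta>\<^sub>j^2\<close>, and these add up to at most \<open>2 * (\<Sum>j. m\<^sub>j * \<beta>\<^sub>j)\<close>. The hypotheses on the
  measure bound \<open>\<beta>\<^sub>j\<close> at time \<open>t\<close> by a multiple of \<open>t^(- s / 2) / R^(2 * s)\<close>, so the total variance is
  of order \<open>log R / R^(2 * s)\<close>. The exponential moment at the scale \<open>R^s\<close> is therefore polynomial in
  \<open>R\<close>, uniformly in \<open>n\<close>, and Fatou's lemma passes to the limit. Summing over the frequencies
  \<open>k^(1 / (1 + s))\<close>, whose gaps at \<open>R\<close> are at most of order \<open>1 / R^s\<close>, gives the decay along this sequence almost
  surely; in between, the transform is Lipschitz because the path is bounded on \<open>[0, 1]\<close>.
\<close>

section \<open>Exponential moments of sums of random phases\<close>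

text \<open>Second-order Taylor expansion; the remainder is evaluated at a point \<open>t\<close>
  with \<open>\<bar>t\<bar> \<le> B\<close>, so \<open>exp B\<close> dominates its
  coefficient.\<close>

lemma exp_le_quadratic:
  fixes x B :: real
  assumes "\<bar>x\<bar> \<le> B"
  shows "exp x \<le> 1 + x + exp B * x\<^sup>2"
proof -
  obtain t where t: "\<bar>t\<bar> \<le> \<bar>x\<bar>" "exp x = (\<Sum>m<2. x ^ m / fact m) + exp t / fact 2 * x ^ 2"
    using Maclaurin_exp_le by blast
  have "exp t / 2 * x\<^sup>2 \<le> exp B * x\<^sup>2"
  proof (rule mult_right_mono)
    have "exp t \<le> exp B" using t(1) assms by simp
    then show "exp t / 2 \<le> exp B"
      using exp_gt_zero[of t] by linarith
  qed simp
  then show ?thesis using t(2) by (simp add: numeral_2_eq_2)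
qed

text \<open>With the mean taken out, the exponent is \<open>Re a * \<rho> + Y\<close>, where
  \<open>Y\<close> is centred, bounded by \<open>2 * A\<close> and has second moment at most
  \<open>(cmod a)\<^sup>2 * (1 - \<rho>\<^sup>2)\<close>, because a random unit vector with mean
  \<rho> has variance \<open>1 - \<rho>\<^sup>2\<close>. The quadratic bound for \<open>exp\<close>
  and \<open>1 + x \<le> exp x\<close> finish. A complex \<open>a\<close> covers every direction of
  the plane at once.\<close>

lemma (in prob_space) unit_circle_mgf_le:
  fixes \<eta> :: "'a \<Rightarrow> complex"
  assumes meas: "\<eta> \<in> borel_measurable M"
    and unit: "\<And>x. cmod (\<eta> x) = 1"
    and mean: "expectation \<eta> = complex_of_real \<rho>"
    and a: "cmod a \<le> A"
  shows "(\<integral>\<^sup>+x. ennreal (exp (Re (a * \<eta> x))) \<partial>M)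
    \<le> ennreal (exp (Re a * \<rho> + exp (2 * A) * (cmod a)\<^sup>2 * (1 - \<rho>\<^sup>2)))"
proof -
  note [measurable] = meas
  have int: "integrable M \<eta>"
    by (rule integrable_const_bound[where B = 1]) (simp_all add: unit)
  have intR: "integrable M (\<lambda>x. Re (\<eta> x))" using int by simp
  have meanR: "expectation (\<lambda>x. Re (\<eta> x)) = \<rho>"
    using mean int by (simp add: integral_Re)
  have "cmod (expectation \<eta>) \<le> expectation (\<lambda>x. cmod (\<eta> x))"
    by (rule integral_norm_bound)
  then have \<rho>1: "\<bar>\<rho>\<bar> \<le> 1" by (simp add: mean unit prob_space)
  define Y where "Y x = Re (a * (\<eta> x - complex_of_real \<rho>))" for x
  have [measurable]: "Y \<in> borel_measurable M" unfolding Y_def by measurable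
  \<comment> \<open>Unit modulus turns the squared distance from \<open>\<eta> x\<close> to \<rho>
    into an affine function of \<open>Re (\<eta> x)\<close>, so its expectation needs only the
    mean.\<close>
  have Ysq: "(Y x)\<^sup>2 \<le> (cmod a)\<^sup>2 * (1 - 2 * \<rho> * Re (\<eta> x) + \<rho>\<^sup>2)" for x
  proof -
    have "\<bar>Y x\<bar> \<le> cmod a * cmod (\<eta> x - complex_of_real \<rho>)"
      unfolding Y_def using abs_Re_le_cmod[of "a * (\<eta> x - complex_of_real \<rho>)"]
      by (simp add: norm_mult)
    then have "(Y x)\<^sup>2 \<le> (cmod a * cmod (\<eta> x - complex_of_real \<rho>))\<^sup>2"
      using power_mono[of "\<bar>Y x\<bar>" _ 2] by simp
    also have "\<dots> = (cmod a)\<^sup>2 * (cmod (\<eta> x - complex_of_real \<rho>))\<^sup>2"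
      by (rule power_mult_distrib)
    also have "(cmod (\<eta> x - complex_of_real \<rho>))\<^sup>2
        = (Re (\<eta> x))\<^sup>2 + (Im (\<eta> x))\<^sup>2 - 2 * \<rho> * Re (\<eta> x) + \<rho>\<^sup>2"
      unfolding cmod_power2 by (simp add: power2_eq_square algebra_simps)
    also have "(Re (\<eta> x))\<^sup>2 + (Im (\<eta> x))\<^sup>2 = 1"
      using unit[of x] cmod_power2[of "\<eta> x"] by simp
    finally show ?thesis
      by (simp add: algebra_simps)
  qed
  have Yb: "\<bar>Y x\<bar> \<le> 2 * A" for x
  proof -
    have "\<bar>Y x\<bar> \<le> cmod a * cmod (\<eta> x - complex_of_real \<rho>)"
      unfolding Y_def using abs_Re_le_cmod[of "a * (\<eta> x - complex_of_real \<rho>)"]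
      by (simp add: norm_mult)
    also have "\<dots> \<le> A * 2"
    proof (rule mult_mono)
      show "cmod (\<eta> x - complex_of_real \<rho>) \<le> 2"
        using norm_triangle_ineq4[of "\<eta> x" "complex_of_real \<rho>"] unit[of x] \<rho>1 by simp
    qed (use a order_trans[OF norm_ge_zero a] in simp_all)
    finally show ?thesis by simp
  qed
  have intY: "integrable M Y"
    by (rule integrable_const_bound[where B = "2 * A"]) (simp_all add: Yb)
  have intY2: "integrable M (\<lambda>x. (Y x)\<^sup>2)"
  proof (rule integrable_const_bound[where B = "(2 * A)\<^sup>2"])
    have "(Y x)\<^sup>2 \<le> (2 * A)\<^sup>2" for x
      using power_mono[OF Yb[of x], of 2] by simp
    then show "AE x in M. norm ((Y x)\<^sup>2) \<le> (2 * A)\<^sup>2" by simp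
  qed measurable
  have EY: "expectation Y = 0"
  proof -
    have "expectation (\<lambda>x. a * (\<eta> x - complex_of_real \<rho>)) = 0"
      using int by (simp add: mean prob_space)
    then show ?thesis
      unfolding Y_def using int by (subst integral_Re) auto
  qed
  have EY2: "expectation (\<lambda>x. (Y x)\<^sup>2) \<le> (cmod a)\<^sup>2 * (1 - \<rho>\<^sup>2)"
  proof -
    have "expectation (\<lambda>x. (Y x)\<^sup>2)
        \<le> expectation (\<lambda>x. (cmod a)\<^sup>2 * (1 - 2 * \<rho> * Re (\<eta> x) + \<rho>\<^sup>2))"
      by (rule integral_mono) (use intY2 intR Ysq in auto)
    also have "\<dots> = (cmod a)\<^sup>2 * (1 - \<rho>\<^sup>2)"
      using intR by (simp add: meanR prob_space power2_eq_square algebra_simps)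
    finally show ?thesis .
  qed
  have "(\<integral>\<^sup>+x. ennreal (exp (Re (a * \<eta> x))) \<partial>M)
      \<le> (\<integral>\<^sup>+x. ennreal (exp (Re a * \<rho>) * (1 + Y x + exp (2 * A) * (Y x)\<^sup>2)) \<partial>M)"
  proof (intro nn_integral_mono ennreal_leI)
    fix x
    have "exp (Re (a * \<eta> x)) = exp (Re a * \<rho>) * exp (Y x)"
      by (simp add: Y_def exp_add[symmetric] algebra_simps)
    also have "\<dots> \<le> exp (Re a * \<rho>) * (1 + Y x + exp (2 * A) * (Y x)\<^sup>2)"
      by (intro mult_left_mono exp_le_quadratic Yb) simp
    finally show "exp (Re (a * \<eta> x)) \<le> exp (Re a * \<rho>) * (1 + Y x + exp (2 * A) * (Y x)\<^sup>2)" .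
  qed
  also have "\<dots> = ennreal (expectation (\<lambda>x. exp (Re a * \<rho>) * (1 + Y x + exp (2 * A) * (Y x)\<^sup>2)))"
  proof (rule nn_integral_eq_integral)
    have "0 \<le> exp (Re a * \<rho>) * (1 + Y x + exp (2 * A) * (Y x)\<^sup>2)" for x
      using order_trans[OF exp_ge_zero exp_le_quadratic[OF Yb[of x]]] by (intro mult_nonneg_nonneg) auto
    then show "AE x in M. 0 \<le> exp (Re a * \<rho>) * (1 + Y x + exp (2 * A) * (Y x)\<^sup>2)" by simp
  qed (use intY intY2 in auto)
  also have "expectation (\<lambda>x. exp (Re a * \<rho>) * (1 + Y x + exp (2 * A) * (Y x)\<^sup>2))
      = exp (Re a * \<rho>) * (1 + exp (2 * A) * expectation (\<lambda>x. (Y x)\<^sup>2))"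
    using intY intY2 by (simp add: EY prob_space)
  also have "ennreal \<dots> \<le> ennreal (exp (Re a * \<rho>) * exp (exp (2 * A) * (cmod a)\<^sup>2 * (1 - \<rho>\<^sup>2)))"
  proof (intro ennreal_leI mult_left_mono)
    have "1 + exp (2 * A) * expectation (\<lambda>x. (Y x)\<^sup>2)
        \<le> 1 + exp (2 * A) * ((cmod a)\<^sup>2 * (1 - \<rho>\<^sup>2))"
      using EY2 by simp
    also have "\<dots> \<le> exp (exp (2 * A) * ((cmod a)\<^sup>2 * (1 - \<rho>\<^sup>2)))"
      by (rule exp_ge_add_one_self)
    finally show "1 + exp (2 * A) * expectation (\<lambda>x. (Y x)\<^sup>2)
        \<le> exp (exp (2 * A) * (cmod a)\<^sup>2 * (1 - \<rho>\<^sup>2))" by (simp add: mult.assoc)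
  qed simp
  finally show ?thesis by (simp add: exp_add)
qed

text \<open>
  The sum is split at step \<open>k\<close>: the terms from \<open>k\<close> on are replaced by their conditional
  expectation \<open>\<rho> * \<beta> k\<close> times the current phase.
\<close>

lemma phase_sum_mgf_le:
  fixes \<eta> :: "'a \<Rightarrow> complex" and m \<beta> :: "nat \<Rightarrow> real"
  assumes N: "prob_space N"
    and meas: "\<eta> \<in> borel_measurable N"
    and unit: "\<And>x. cmod (\<eta> x) = 1"
    and mean: "integral\<^sup>L N \<eta> = complex_of_real \<rho>"
    and rec: "\<And>j. j < n \<Longrightarrow> \<beta> j = m j + \<rho> * \<beta> (Suc j)"
    and bound: "\<And>j. j < n \<Longrightarrow> cmod a * \<bar>\<beta> j\<bar> \<le> A"
    and "k \<le> n"
  shows "(\<integral>\<^sup>+x. ennreal (exp (Re (a * ((\<Sum>j<k. m j * (\<Prod>i<Suc j. \<eta> (x i)))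
            + \<rho> * \<beta> k * (\<Prod>i<k. \<eta> (x i)))))) \<partial>PiM {..<k} (\<lambda>_. N))
    \<le> ennreal (exp (Re a * \<rho> * \<beta> 0
        + exp (2 * A) * (cmod a)\<^sup>2 * (1 - \<rho>\<^sup>2) * (\<Sum>j<k. (\<beta> j)\<^sup>2)))"
  using \<open>k \<le> n\<close>
proof (induction k)
  case 0
  interpret N: prob_space N by (rule N)
  show ?case by (simp add: PiM_empty nn_integral_count_space_finite mult.assoc)
next
  case (Suc k)
  interpret N: prob_space N by (rule N)
  interpret product_prob_space "\<lambda>_. N" by unfold_locales
  note [measurable] = meas
  define S where "S x = (\<Sum>j<k. m j * (\<Prod>i<Suc j. \<eta> (x i)))" for x :: "nat \<Rightarrow> 'a"
  define P where "P x = (\<Prod>i<k. \<eta> (x i))" for x :: "nat \<Rightarrow> 'a"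
  define Q where "Q = exp (2 * A) * (cmod a)\<^sup>2 * (1 - \<rho>\<^sup>2) * (\<beta> k)\<^sup>2"
  have [measurable]: "(\<lambda>x. \<eta> (x i)) \<in> borel_measurable (PiM I (\<lambda>_. N))" if "i \<in> I" for i and I :: "nat set"
    using that by measurable
  have Smeas: "S \<in> borel_measurable (PiM {..<k} (\<lambda>_. N))"
    unfolding S_def
    by (intro borel_measurable_sum borel_measurable_times borel_measurable_const borel_measurable_prod) auto
  have Pmeas: "P \<in> borel_measurable (PiM {..<k} (\<lambda>_. N))"
    unfolding P_def by (intro borel_measurable_prod) auto
  note [measurable] = Smeas Pmeas
  have k: "k < n" using Suc.prems by simp
  have unitP: "cmod (P x) = 1" for x by (simp add: P_def unit prod_norm[symmetric])
  \<comment> \<open>The term of index \<open>k\<close> and the conditional mean of the later ones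
    carry the same phase \<open>P x * \<eta> y\<close>, so the recursion merges their coefficients
    into \<open>\<beta> k\<close>.\<close>
  have split: "((\<Sum>j<Suc k. m j * (\<Prod>i<Suc j. \<eta> ((x(k := y)) i)))
      + \<rho> * \<beta> (Suc k) * (\<Prod>i<Suc k. \<eta> ((x(k := y)) i))) = S x + \<beta> k * P x * \<eta> y" for x y
  proof -
    have "(\<Sum>j<k. m j * (\<Prod>i<Suc j. \<eta> ((x(k := y)) i))) = S x"
      unfolding S_def by (intro sum.cong arg_cong2[where f = "(*)"] prod.cong) auto
    moreover have "(\<Prod>i<k. \<eta> ((x(k := y)) i)) = P x"
      unfolding P_def by (intro prod.cong) auto
    ultimately show ?thesis
      by (simp add: rec[OF k] algebra_simps)
  qed
  \<comment> \<open>Only the newest phase is integrated while the earlier coordinates stay fixed.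
    Since \<open>P x\<close> has modulus 1, the cost \<open>exp Q\<close> does not depend on
    them.\<close>
  have inner: "(\<integral>\<^sup>+y. ennreal (exp (Re (a * (S x + \<beta> k * P x * \<eta> y)))) \<partial>N)
      \<le> ennreal (exp (Re (a * (S x + \<rho> * \<beta> k * P x)))) * ennreal (exp Q)" for x
  proof -
    have "(\<integral>\<^sup>+y. ennreal (exp (Re (a * (S x + \<beta> k * P x * \<eta> y)))) \<partial>N)
        = (\<integral>\<^sup>+y. ennreal (exp (Re (a * S x))) * ennreal (exp (Re ((a * \<beta> k * P x) * \<eta> y))) \<partial>N)"
      by (intro nn_integral_cong) (simp add: ennreal_mult[symmetric] exp_add[symmetric] algebra_simps)
    also have "\<dots> = ennreal (exp (Re (a * S x))) * (\<integral>\<^sup>+y. ennreal (exp (Re ((a * \<beta> k * P x) * \<eta> y))) \<partial>N)"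
      by (rule nn_integral_cmult) measurable
    also have "\<dots> \<le> ennreal (exp (Re (a * S x)))
        * ennreal (exp (Re (a * \<beta> k * P x) * \<rho> + exp (2 * A) * (cmod (a * \<beta> k * P x))\<^sup>2 * (1 - \<rho>\<^sup>2)))"
      by (intro mult_left_mono N.unit_circle_mgf_le meas unit mean)
         (use bound[OF k] in \<open>simp_all add: norm_mult unitP\<close>)
    also have "\<dots> = ennreal (exp (Re (a * (S x + \<rho> * \<beta> k * P x)))) * ennreal (exp Q)"
      unfolding Q_def
      by (simp add: ennreal_mult[symmetric] exp_add[symmetric] norm_mult unitP power_mult_distrib)
         (simp add: algebra_simps)
    finally show ?thesis .
  qed
  have "(\<integral>\<^sup>+x. ennreal (exp (Re (a * ((\<Sum>j<Suc k. m j * (\<Prod>i<Suc j. \<eta> (x i)))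
            + \<rho> * \<beta> (Suc k) * (\<Prod>i<Suc k. \<eta> (x i)))))) \<partial>PiM {..<Suc k} (\<lambda>_. N))
      = (\<integral>\<^sup>+x. (\<integral>\<^sup>+y. ennreal (exp (Re (a * (S x + \<beta> k * P x * \<eta> y)))) \<partial>N) \<partial>PiM {..<k} (\<lambda>_. N))"
    unfolding lessThan_Suc
  proof (subst product_nn_integral_insert)
    show "(\<lambda>x. ennreal (exp (Re (a * ((\<Sum>j\<in>insert k {..<k}. m j * (\<Prod>i\<in>insert j {..<j}. \<eta> (x i)))
            + \<rho> * \<beta> (Suc k) * (\<Prod>i\<in>insert k {..<k}. \<eta> (x i)))))))
          \<in> borel_measurable (PiM (insert k {..<k}) (\<lambda>_. N))"
      by (intro measurable_compose[OF _ measurable_ennreal] measurable_compose[OF _ borel_measurable_exp]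
            measurable_compose[OF _ borel_measurable_Re]
            borel_measurable_sum borel_measurable_times borel_measurable_add
            borel_measurable_const borel_measurable_prod) auto
  qed (simp_all only: finite_lessThan lessThan_iff less_irrefl not_False_eq_True simp_thms
        lessThan_Suc[symmetric] split)
  also have "\<dots> \<le> (\<integral>\<^sup>+x. ennreal (exp (Re (a * (S x + \<rho> * \<beta> k * P x)))) * ennreal (exp Q) \<partial>PiM {..<k} (\<lambda>_. N))"
    by (intro nn_integral_mono inner)
  also have "\<dots> = (\<integral>\<^sup>+x. ennreal (exp (Re (a * (S x + \<rho> * \<beta> k * P x)))) \<partial>PiM {..<k} (\<lambda>_. N)) * ennreal (exp Q)"
    by (rule nn_integral_multc) measurable
  also have "\<dots> \<le> ennreal (exp (Re a * \<rho> * \<beta> 0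
        + exp (2 * A) * (cmod a)\<^sup>2 * (1 - \<rho>\<^sup>2) * (\<Sum>j<k. (\<beta> j)\<^sup>2))) * ennreal (exp Q)"
    using Suc.IH k unfolding S_def P_def by (intro mult_right_mono) auto
  also have "\<dots> = ennreal (exp (Re a * \<rho> * \<beta> 0
        + exp (2 * A) * (cmod a)\<^sup>2 * (1 - \<rho>\<^sup>2) * (\<Sum>j<Suc k. (\<beta> j)\<^sup>2)))"
    unfolding Q_def by (simp add: ennreal_mult[symmetric] exp_add[symmetric] algebra_simps)
  finally show ?case .
qed

text \<open>Factoring \<open>(\<beta> j)\<^sup>2 - (\<rho> * \<beta> (Suc j))\<^sup>2\<close> as a
  difference of squares leaves \<open>m j\<close> times at most \<open>2 * \<beta> j\<close>; these
  inequalities are then summed. This keeps the total variance bounded independently of the number of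
  grid steps.\<close>

lemma discounted_sum_square_le:
  fixes m \<beta> :: "nat \<Rightarrow> real"
  assumes rec: "\<And>j. j < n \<Longrightarrow> \<beta> j = m j + \<rho> * \<beta> (Suc j)"
    and "\<beta> n = 0" and m: "\<And>j. 0 \<le> m j" and \<beta>: "\<And>j. 0 \<le> \<beta> j" and "0 \<le> \<rho>"
  shows "(1 - \<rho>\<^sup>2) * (\<Sum>j<n. (\<beta> j)\<^sup>2) \<le> 2 * (\<Sum>j<n. m j * \<beta> j)"
proof -
  have step: "(\<beta> j)\<^sup>2 \<le> 2 * (m j * \<beta> j) + \<rho>\<^sup>2 * (\<beta> (Suc j))\<^sup>2" if "j < n" for j
  proof -
    have "(\<beta> j)\<^sup>2 - \<rho>\<^sup>2 * (\<beta> (Suc j))\<^sup>2 = m j * (\<beta> j + \<rho> * \<beta> (Suc j))"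
      using rec[OF that] by (simp add: power2_eq_square algebra_simps)
    also have "\<dots> \<le> m j * (2 * \<beta> j)"
      using rec[OF that] m[of j] by (intro mult_left_mono) auto
    finally show ?thesis by simp
  qed
  have "(\<Sum>j<n. (\<beta> j)\<^sup>2) \<le> (\<Sum>j<n. 2 * (m j * \<beta> j) + \<rho>\<^sup>2 * (\<beta> (Suc j))\<^sup>2)"
    by (intro sum_mono step) simp
  also have "\<dots> = 2 * (\<Sum>j<n. m j * \<beta> j) + \<rho>\<^sup>2 * (\<Sum>j<n. (\<beta> (Suc j))\<^sup>2)"
    by (simp add: sum.distrib sum_distrib_left)
  \<comment> \<open>The shifted sum is at most the unshifted one: the new last term is
    \<open>\<beta> n = 0\<close> and the lost first term is a square.\<close>
  also have "\<dots> \<le> 2 * (\<Sum>j<n. m j * \<beta> j) + \<rho>\<^sup>2 * (\<Sum>j<n. (\<beta> j)\<^sup>2)"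
    using sum.lessThan_Suc_shift[of "\<lambda>j. (\<beta> j)\<^sup>2" n] \<open>\<beta> n = 0\<close>
    by (intro add_left_mono mult_left_mono) simp_all
  finally show ?thesis by (simp add: left_diff_distrib)
qed

section \<open>Measures with Frostman-type bounds\<close>

text \<open>Sums of weighted indicators are integrated term by term below and must not be simplified
  to sums over filtered index sets.\<close>

lemmas [simp del] = sum_mult_indicator sum_indicator_mult

text \<open>The interval bound is required at every positive \<open>x\<close>, not just on the
  support; \<open>frostman_measure_of_support_bound\<close> supplies it with the same
  \<open>K\<close>. The measure lives on the whole line, so integrands need no restriction to the
  unit interval.\<close>

locale frostman_measure = finite_measure \<nu>
  for \<nu> :: "real measure" +
  fixes s K :: real
  assumes sets_eq_borel [measurable_cong, simp]: "sets \<nu> = sets borel"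
    and concentrated: "AE u in \<nu>. 0 \<le> u \<and> u \<le> 1"
    and s_pos: "0 < s"
    and measure_origin_le: "0 < r \<Longrightarrow> measure \<nu> {0..r} \<le> K * r powr (s / 2)"
    and measure_interval_le:
      "\<lbrakk>0 < x; 0 < r\<rbrakk> \<Longrightarrow> measure \<nu> {x..x + r} \<le> K * x powr (- s / 2) * r powr s"
begin

lemma space_eq_UNIV [simp]: "space \<nu> = UNIV"
  using sets_eq_imp_space_eq[OF sets_eq_borel] by simp

lemma K_nonneg: "0 \<le> K"
  using order_trans[OF measure_nonneg measure_origin_le[of 1]] by simp

text \<open>The interval from \<open>x\<close> to 1 is covered by blocks of length \<open>h\<close>.
  On block \<open>l\<close> the kernel is at most \<open>exp (- l)\<close>, and the mass bound at
  its left end is no worse than the one at \<open>x\<close>. The geometric series with ratio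
  \<open>exp (- 1) \<le> 1 / 2\<close> sums to at most 2.\<close>

lemma exponential_potential_le:
  assumes x: "0 < x" and h: "0 < h"
  shows "(LINT u|\<nu>. indicator {x<..1} u * exp (- ((u - x) / h))) \<le> 2 * K * x powr (- s / 2) * h powr s"
proof -
  define L where "L = nat \<lceil>1 / h\<rceil> + 1"
  have pointwise: "indicator {x<..1} u * exp (- ((u - x) / h))
      \<le> (\<Sum>l<L. exp (- real l) * indicator {x + real l * h..x + real l * h + h} u)" for u
  proof (cases "u \<in> {x<..1}")
    case True
    define l where "l = nat \<lfloor>(u - x) / h\<rfloor>"
    have nonneg: "0 \<le> (u - x) / h" using True h by simp
    then have l: "real l \<le> (u - x) / h" "(u - x) / h < real l + 1"
      unfolding l_def by linarith+
    have "(u - x) / h \<le> 1 / h" using True x h by (intro divide_right_mono) auto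
    then have "l < L" using l unfolding L_def by linarith
    have mem: "u \<in> {x + real l * h..x + real l * h + h}"
      using l h by (auto simp: field_simps)
    have "exp (- ((u - x) / h)) \<le> exp (- real l) * indicator {x + real l * h..x + real l * h + h} u"
      using l mem by simp
    also have "\<dots> \<le> (\<Sum>l<L. exp (- real l) * indicator {x + real l * h..x + real l * h + h} u)"
      by (rule member_le_sum) (use \<open>l < L\<close> in auto)
    finally show ?thesis using True by simp
  qed (auto intro!: sum_nonneg)
  have "(LINT u|\<nu>. indicator {x<..1} u * exp (- ((u - x) / h)))
      \<le> (LINT u|\<nu>. (\<Sum>l<L. exp (- real l) * indicator {x + real l * h..x + real l * h + h} u))"
  proof (rule integral_mono)
    show "integrable \<nu> (\<lambda>u. indicator {x<..1} u * exp (- ((u - x) / h)))"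
      by (rule integrable_const_bound[where B = 1]) (use h in \<open>auto simp: indicator_def\<close>)
  qed (use pointwise in \<open>auto intro!: Bochner_Integration.integrable_sum integrable_mult_right integrable_real_indicator simp: emeasure_eq_measure\<close>)
  also have "\<dots> = (\<Sum>l<L. exp (- real l) * measure \<nu> {x + real l * h..x + real l * h + h})"
    by (subst Bochner_Integration.integral_sum)
       (auto intro!: Bochner_Integration.integrable_sum integrable_mult_right integrable_real_indicator simp: emeasure_eq_measure)
  also have "\<dots> \<le> (\<Sum>l<L. exp (- real l) * (K * x powr (- s / 2) * h powr s))"
  proof (intro sum_mono mult_left_mono)
    fix l
    have "measure \<nu> {x + real l * h..x + real l * h + h} \<le> K * (x + real l * h) powr (- s / 2) * h powr s"
      using x h by (intro measure_interval_le) (auto intro: add_pos_nonneg)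
    also have "\<dots> \<le> K * x powr (- s / 2) * h powr s"
      using x h s_pos K_nonneg by (intro mult_right_mono mult_left_mono powr_mono2') auto
    finally show "measure \<nu> {x + real l * h..x + real l * h + h} \<le> K * x powr (- s / 2) * h powr s" .
  qed simp
  also have "\<dots> = (\<Sum>l<L. exp (- 1) ^ l) * (K * x powr (- s / 2) * h powr s)"
    by (simp add: sum_distrib_right exp_of_nat_mult[symmetric])
  also have "\<dots> \<le> 2 * (K * x powr (- s / 2) * h powr s)"
  proof (rule mult_right_mono)
    have e: "exp (- 1 :: real) \<le> 1 / 2"
      using exp_ge_add_one_self[of "1 :: real"] by (simp add: exp_minus field_simps)
    have "(\<Sum>l<L. exp (- 1 :: real) ^ l) \<le> (\<Sum>l. exp (- 1 :: real) ^ l)"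
      by (rule sum_le_suminf) (auto intro!: summable_geometric)
    also have "\<dots> = 1 / (1 - exp (- 1))"
      by (rule suminf_geometric) simp
    also have "\<dots> \<le> 2" using e by (simp add: field_simps)
    finally show "(\<Sum>l<L. exp (- 1 :: real) ^ l) \<le> 2" .
  qed (use K_nonneg in simp)
  finally show ?thesis by (simp add: mult.assoc)
qed

lemma integrable_truncated_power:
  assumes "0 < \<delta>"
  shows "integrable \<nu> (\<lambda>u. indicator {\<delta><..1} u * u powr (- s / 2))"
proof (rule integrable_const_bound[where B = "\<delta> powr (- s / 2)"])
  show "AE u in \<nu>. norm (indicator {\<delta><..1} u * u powr (- s / 2)) \<le> \<delta> powr (- s / 2)"
    using assms s_pos by (intro AE_I2) (auto simp: indicator_def intro!: powr_mono2')
qed measurable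

text \<open>Dyadic decomposition: where \<open>u\<close> lies between
  \<open>2 powr (- (i + 1))\<close> and \<open>2 powr (- i)\<close>, the growth of the power cancels
  the decay of the mass near the origin, so each scale contributes at most
  \<open>K * 2 powr (s / 2)\<close>. The number of scales down to \<delta> produces the logarithm of
  the theorem.\<close>

lemma truncated_power_integral_le:
  assumes \<delta>: "0 < \<delta>" "\<delta> \<le> 1"
  shows "(LINT u|\<nu>. indicator {\<delta><..1} u * u powr (- s / 2))
    \<le> K * 2 powr (s / 2) * (1 + log 2 (1 / \<delta>))"
proof -
  define L where "L = nat \<lfloor>log 2 (1 / \<delta>)\<rfloor> + 1"
  have log_nonneg: "0 \<le> log 2 (1 / \<delta>)" using \<delta> by (simp add: zero_le_log_cancel_iff)
  have pointwise: "indicator {\<delta><..1} u * u powr (- s / 2)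
      \<le> (\<Sum>i<L. 2 powr ((real i + 1) * (s / 2)) * indicator {0..2 powr (- real i)} u)" for u
  proof (cases "u \<in> {\<delta><..1}")
    case True
    then have u: "0 < u" "\<delta> < u" "u \<le> 1" using \<delta> by auto
    define i where "i = nat \<lfloor>log 2 (1 / u)\<rfloor>"
    have "0 \<le> log 2 (1 / u)" using u by simp
    then have i: "real i \<le> log 2 (1 / u)" "log 2 (1 / u) < real i + 1"
      unfolding i_def by linarith+
    have "log 2 (1 / u) \<le> log 2 (1 / \<delta>)"
      using u \<delta> by (simp add: frac_le)
    then have "i < L" unfolding i_def L_def by (meson floor_mono less_add_one nat_mono order_le_less_trans)
    have logu: "log 2 (1 / u) = - log 2 u" using u by (simp add: log_divide)
    have "u = 2 powr (log 2 u)" using u by simp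
    also have "\<dots> \<le> 2 powr (- real i)" using i logu by (intro powr_mono) auto
    finally have mem: "u \<in> {0..2 powr (- real i)}" using u by simp
    have "u powr (- s / 2) = 2 powr (log 2 u * (- s / 2))"
      using u by (subst powr_powr[symmetric]) simp
    also have "\<dots> \<le> 2 powr ((real i + 1) * (s / 2))"
    proof (rule powr_mono)
      have "- log 2 u * (s / 2) \<le> (real i + 1) * (s / 2)"
        using i logu s_pos by (intro mult_right_mono) auto
      then show "log 2 u * (- s / 2) \<le> (real i + 1) * (s / 2)" by simp
    qed simp
    finally have "u powr (- s / 2) \<le> 2 powr ((real i + 1) * (s / 2)) * indicator {0..2 powr (- real i)} u"
      using mem by simp
    also have "\<dots> \<le> (\<Sum>i<L. 2 powr ((real i + 1) * (s / 2)) * indicator {0..2 powr (- real i)} u)"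
      by (rule member_le_sum) (use \<open>i < L\<close> in auto)
    finally show ?thesis using True by simp
  qed (auto intro!: sum_nonneg)
  have "(LINT u|\<nu>. indicator {\<delta><..1} u * u powr (- s / 2))
      \<le> (LINT u|\<nu>. (\<Sum>i<L. 2 powr ((real i + 1) * (s / 2)) * indicator {0..2 powr (- real i)} u))"
    by (rule integral_mono[OF integrable_truncated_power[OF \<delta>(1)]])
       (use pointwise in \<open>auto intro!: Bochner_Integration.integrable_sum integrable_mult_right integrable_real_indicator
          simp: emeasure_eq_measure\<close>)
  also have "\<dots> = (\<Sum>i<L. 2 powr ((real i + 1) * (s / 2)) * measure \<nu> {0..2 powr (- real i)})"
    by (subst Bochner_Integration.integral_sum)
       (auto intro!: Bochner_Integration.integrable_sum integrable_mult_right integrable_real_indicator simp: emeasure_eq_measure)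
  also have "\<dots> \<le> (\<Sum>i<L. K * 2 powr (s / 2))"
  proof (rule sum_mono)
    fix i
    have "2 powr ((real i + 1) * (s / 2)) * measure \<nu> {0..2 powr (- real i)}
        \<le> 2 powr ((real i + 1) * (s / 2)) * (K * (2 powr (- real i)) powr (s / 2))"
      by (intro mult_left_mono measure_origin_le) auto
    also have "\<dots> = K * 2 powr ((real i + 1) * (s / 2) + (- real i) * (s / 2))"
      unfolding powr_add powr_powr by (simp add: mult_ac)
    also have "(real i + 1) * (s / 2) + (- real i) * (s / 2) = s / 2"
      by (simp add: algebra_simps)
    finally show "2 powr ((real i + 1) * (s / 2)) * measure \<nu> {0..2 powr (- real i)} \<le> K * 2 powr (s / 2)" .
  qed
  also have "\<dots> = real L * (K * 2 powr (s / 2))" by simp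
  also have "\<dots> \<le> (1 + log 2 (1 / \<delta>)) * (K * 2 powr (s / 2))"
  proof (rule mult_right_mono)
    show "real L \<le> 1 + log 2 (1 / \<delta>)" using log_nonneg unfolding L_def by linarith
  qed (use K_nonneg in simp)
  finally show ?thesis by (simp add: mult_ac)
qed

section \<open>Grid cells and discounted tail masses\<close>

definition cell :: "real \<Rightarrow> nat \<Rightarrow> nat \<Rightarrow> real set" where
  "cell \<delta> n j = {max \<delta> (real j / real n)<..real (Suc j) / real n}"

lemma cell_sets [measurable, simp]: "cell \<delta> n j \<in> sets borel"
  by (simp add: cell_def)

text \<open>Cells are open on the left, so they are disjoint and \<open>u\<close> belongs to the one
  of index \<open>\<lceil>n * u\<rceil> - 1\<close>. The cut at \<delta> > 0 makes this index
  nonnegative whenever the indicator is nonzero, so \<open>nat\<close> is harmless.\<close>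

lemma indicator_cell:
  assumes "0 < n" "0 < \<delta>"
  shows "indicator (cell \<delta> n j) u
    = (if nat (\<lceil>real n * u\<rceil> - 1) = j then indicator {\<delta><..} u else 0 :: real)"
proof (cases "\<delta> < u")
  case True
  then have "0 < real n * u" using assms by simp
  then have "(real j / real n < u \<and> u \<le> real (Suc j) / real n) \<longleftrightarrow> nat (\<lceil>real n * u\<rceil> - 1) = j"
    using assms by (simp add: field_simps) linarith
  then show ?thesis using True by (simp add: cell_def indicator_def)
qed (auto simp: cell_def indicator_def)

lemma sum_indicator_cell:
  assumes "0 < n" "0 < \<delta>" "finite I"
  shows "(\<Sum>j\<in>I. indicator (cell \<delta> n j) u * f j)
    = (if nat (\<lceil>real n * u\<rceil> - 1) \<in> I then indicator {\<delta><..} u * f (nat (\<lceil>real n * u\<rceil> - 1)) else 0 :: real)"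
proof -
  have "(\<Sum>j\<in>I. indicator (cell \<delta> n j) u * f j)
    = (\<Sum>j\<in>I. if nat (\<lceil>real n * u\<rceil> - 1) = j then indicator {\<delta><..} u * f j else 0)"
    using assms by (intro sum.cong) (auto simp: indicator_cell)
  then show ?thesis using assms by simp
qed

text \<open>The explicit solution of the backward recursion with value 0 at \<open>n\<close>. When
  each phase has mean \<rho>, \<open>\<rho> * tail_mass \<delta> n \<rho> j\<close> is the
  conditional mean of the terms from \<open>j\<close> on, relative to the current phase.\<close>

definition tail_mass :: "real \<Rightarrow> nat \<Rightarrow> real \<Rightarrow> nat \<Rightarrow> real" where
  "tail_mass \<delta> n \<rho> j = (\<Sum>i\<in>{j..<n}. measure \<nu> (cell \<delta> n i) * \<rho> ^ (i - j))"

lemma tail_mass_rec: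
  assumes "j < n"
  shows "tail_mass \<delta> n \<rho> j = measure \<nu> (cell \<delta> n j) + \<rho> * tail_mass \<delta> n \<rho> (Suc j)"
proof -
  have "tail_mass \<delta> n \<rho> j = measure \<nu> (cell \<delta> n j)
      + (\<Sum>i\<in>{Suc j..<n}. measure \<nu> (cell \<delta> n i) * \<rho> ^ (i - j))"
    using assms by (simp add: tail_mass_def sum.atLeast_Suc_lessThan)
  also have "(\<Sum>i\<in>{Suc j..<n}. measure \<nu> (cell \<delta> n i) * \<rho> ^ (i - j)) = \<rho> * tail_mass \<delta> n \<rho> (Suc j)"
    unfolding tail_mass_def sum_distrib_left
  proof (rule sum.cong)
    fix i assume "i \<in> {Suc j..<n}"
    then have "i - j = Suc (i - Suc j)" by auto
    then show "measure \<nu> (cell \<delta> n i) * \<rho> ^ (i - j) = \<rho> * (measure \<nu> (cell \<delta> n i) * \<rho> ^ (i - Suc j))"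
      by simp
  qed simp
  finally show ?thesis .
qed

lemma tail_mass_nonneg: "0 \<le> \<rho> \<Longrightarrow> 0 \<le> tail_mass \<delta> n \<rho> j"
  by (auto simp: tail_mass_def intro!: sum_nonneg)

text \<open>The discount over \<open>i - j\<close> steps is at most exponential decay in time at
  scale \<delta>, so the tail mass is controlled by the exponential potential with
  \<open>h = \<delta>\<close>.\<close>

lemma tail_mass_le:
  assumes R: "1 \<le> R" and n: "R\<^sup>2 \<le> real n" and \<rho>: "0 \<le> \<rho>" "\<rho> \<le> exp (- (R\<^sup>2 / real n))"
    and \<delta>: "\<delta> = 1 / R\<^sup>2"
  shows "tail_mass \<delta> n \<rho> j \<le> 2 * exp 1 * K * max \<delta> (real j / real n) powr (- s / 2) * \<delta> powr s"
proof -
  define x where "x = max \<delta> (real j / real n)"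
  have \<delta>0: "0 < \<delta>" using R \<delta> by simp
  then have x0: "0 < x" by (simp add: x_def)
  have n0: "0 < n" using R n by (metis less_le_trans of_nat_0_less_iff one_le_power zero_less_one)
  have pointwise: "(\<Sum>i\<in>{j..<n}. indicator (cell \<delta> n i) u * \<rho> ^ (i - j))
      \<le> exp 1 * (indicator {x<..1} u * exp (- ((u - x) / \<delta>)))" for u
  proof -
    define i where "i = nat (\<lceil>real n * u\<rceil> - 1)"
    show ?thesis
    proof (cases "i \<in> {j..<n} \<and> \<delta> < u")
      case True
      then have u0: "0 < real n * u" using \<delta>0 n0 by simp
      have i: "real i < real n * u" "real n * u \<le> real i + 1"
        using u0 unfolding i_def by linarith+
      have iu: "real i / real n < u" "u \<le> (real i + 1) / real n"
        using i n0 by (simp_all add: field_simps)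
      have "real j / real n \<le> real i / real n" using True by (simp add: divide_right_mono)
      then have "x < u" using iu True by (simp add: x_def)
      have "(real i + 1) / real n \<le> 1" using True n0 by (simp add: field_simps)
      then have "u \<le> 1" using iu by simp
      have "\<rho> ^ (i - j) \<le> exp (- (R\<^sup>2 / real n)) ^ (i - j)" using \<rho> by (rule power_mono[rotated])
      also have "\<dots> = exp (- (R\<^sup>2 / real n) * (real i - real j))"
        using True by (simp add: exp_of_nat_mult[symmetric] of_nat_diff mult.commute)
      also have "\<dots> \<le> exp (1 + - ((u - x) / \<delta>))"
      proof -
        \<comment> \<open>A point of cell \<open>i\<close> may lie one cell beyond
          \<open>i / n\<close>. As a cell is no longer than \<delta>, this costs one unit in the
          exponent, hence the factor \<open>exp 1\<close>.\<close>
        have "u - x \<le> (real i + 1) / real n - real j / real n"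
          using iu by (simp add: x_def)
        then have "R\<^sup>2 * (u - x) \<le> R\<^sup>2 * ((real i - real j) / real n + 1 / real n)"
          by (intro mult_left_mono) (simp_all add: add_divide_distrib diff_divide_distrib)
        moreover have "R\<^sup>2 * (1 / real n) \<le> 1" using n n0 by simp
        ultimately show ?thesis by (simp add: \<delta> algebra_simps)
      qed
      finally have "\<rho> ^ (i - j) \<le> exp 1 * exp (- ((u - x) / \<delta>))"
        by (simp only: exp_add)
      then show ?thesis
        using True \<open>x < u\<close> \<open>u \<le> 1\<close> n0 \<delta>0 by (simp add: sum_indicator_cell i_def)
    qed (use n0 \<delta>0 in \<open>auto simp: sum_indicator_cell i_def\<close>)
  qed
  have "tail_mass \<delta> n \<rho> j = (LINT u|\<nu>. (\<Sum>i\<in>{j..<n}. indicator (cell \<delta> n i) u * \<rho> ^ (i - j)))"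
    unfolding tail_mass_def
    by (subst Bochner_Integration.integral_sum)
       (auto intro!: Bochner_Integration.integrable_sum integrable_mult_left integrable_real_indicator simp: emeasure_eq_measure)
  also have "\<dots> \<le> (LINT u|\<nu>. exp 1 * (indicator {x<..1} u * exp (- ((u - x) / \<delta>))))"
  proof (rule integral_mono)
    have "integrable \<nu> (\<lambda>u. indicator {x<..1} u * exp (- ((u - x) / \<delta>)))"
      by (rule integrable_const_bound[where B = 1]) (use \<delta>0 in \<open>auto simp: indicator_def\<close>)
    then show "integrable \<nu> (\<lambda>u. exp 1 * (indicator {x<..1} u * exp (- ((u - x) / \<delta>))))"
      by (rule integrable_mult_right)
  qed (use pointwise in \<open>auto intro!: Bochner_Integration.integrable_sum integrable_mult_left integrable_real_indicator simp: emeasure_eq_measure\<close>)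
  also have "\<dots> = exp 1 * (LINT u|\<nu>. indicator {x<..1} u * exp (- ((u - x) / \<delta>)))"
    by simp
  also have "\<dots> \<le> exp 1 * (2 * K * x powr (- s / 2) * \<delta> powr s)"
    by (intro mult_left_mono exponential_potential_le x0 \<delta>0) simp
  finally show ?thesis by (simp add: x_def mult_ac)
qed

text \<open>Cells are no longer than \<delta>, so each \<open>u\<close> in cell \<open>i\<close> is
  at most twice \<open>max \<delta> (i / n)\<close>. At the price of \<open>2 powr (s / 2)\<close>
  the sum becomes the truncated power integral, which contributes the same factor again.\<close>

lemma sum_cell_power_le:
  assumes R: "1 \<le> R" and n: "R\<^sup>2 \<le> real n" and \<delta>: "\<delta> = 1 / R\<^sup>2"
  shows "(\<Sum>j<n. measure \<nu> (cell \<delta> n j) * max \<delta> (real j / real n) powr (- s / 2))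
    \<le> K * 2 powr s * (1 + log 2 (R\<^sup>2))"
proof -
  have \<delta>0: "0 < \<delta>" and "\<delta> \<le> 1" using R \<delta> by simp_all
  have n0: "0 < n" using R n by (metis less_le_trans of_nat_0_less_iff one_le_power zero_less_one)
  have pointwise: "(\<Sum>j<n. indicator (cell \<delta> n j) u * max \<delta> (real j / real n) powr (- s / 2))
      \<le> 2 powr (s / 2) * (indicator {\<delta><..1} u * u powr (- s / 2))" for u
  proof -
    define i where "i = nat (\<lceil>real n * u\<rceil> - 1)"
    show ?thesis
    proof (cases "i < n \<and> \<delta> < u")
      case True
      then have u0: "0 < real n * u" using \<delta>0 n0 by simp
      have i: "real n * u \<le> real i + 1"
        using u0 unfolding i_def by linarith
      have iu: "u \<le> (real i + 1) / real n"
        using i n0 by (simp add: field_simps)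
      have "(real i + 1) / real n \<le> 1" using True n0 by (simp add: field_simps)
      then have "u \<le> 1" using iu by simp
      have "1 / real n \<le> \<delta>" using n R n0 unfolding \<delta> by (intro frac_le) auto
      then have "u \<le> 2 * max \<delta> (real i / real n)"
        using iu by (simp add: add_divide_distrib)
      then have "(2 * max \<delta> (real i / real n)) powr (- s / 2) \<le> u powr (- s / 2)"
        using s_pos True \<delta>0 by (intro powr_mono2') auto
      then have "max \<delta> (real i / real n) powr (- s / 2) \<le> 2 powr (s / 2) * u powr (- s / 2)"
        using \<delta>0 by (simp add: powr_mult powr_minus field_simps)
      then show ?thesis
        using True \<open>u \<le> 1\<close> n0 \<delta>0 by (simp add: sum_indicator_cell i_def)
    qed (use n0 \<delta>0 in \<open>auto simp: sum_indicator_cell i_def\<close>)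
  qed
  have "(\<Sum>j<n. measure \<nu> (cell \<delta> n j) * max \<delta> (real j / real n) powr (- s / 2))
      = (LINT u|\<nu>. (\<Sum>j<n. indicator (cell \<delta> n j) u * max \<delta> (real j / real n) powr (- s / 2)))"
    by (subst Bochner_Integration.integral_sum)
       (auto intro!: Bochner_Integration.integrable_sum integrable_mult_left integrable_real_indicator simp: emeasure_eq_measure)
  also have "\<dots> \<le> (LINT u|\<nu>. 2 powr (s / 2) * (indicator {\<delta><..1} u * u powr (- s / 2)))"
    by (rule integral_mono[OF _ integrable_mult_right[OF integrable_truncated_power[OF \<delta>0]]])
       (use pointwise in \<open>auto intro!: Bochner_Integration.integrable_sum integrable_mult_left integrable_real_indicator simp: emeasure_eq_measure\<close>)
  also have "\<dots> = 2 powr (s / 2) * (LINT u|\<nu>. indicator {\<delta><..1} u * u powr (- s / 2))"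
    by simp
  also have "\<dots> \<le> 2 powr (s / 2) * (K * 2 powr (s / 2) * (1 + log 2 (1 / \<delta>)))"
    by (intro mult_left_mono truncated_power_integral_le \<delta>0 \<open>\<delta> \<le> 1\<close>) simp
  also have "\<dots> = K * 2 powr s * (1 + log 2 (R\<^sup>2))"
    by (simp add: \<delta> powr_half_sqrt[symmetric] powr_add[symmetric] mult_ac)
  finally show ?thesis .
qed

end

section \<open>Brownian increments and the passage to the limit\<close>

lemma cis_sum: "finite I \<Longrightarrow> cis (\<Sum>i\<in>I. f i) = (\<Prod>i\<in>I. cis (f i))"
  by (induction I rule: finite_induct) (simp_all add: cis_mult[symmetric])

context brownian_motion
begin

text \<open>After division by its standard deviation the increment is standard normal, and its
  characteristic function is known.\<close>

lemma expectation_cis_increment: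
  assumes "0 \<le> a" "a < b"
  shows "expectation (\<lambda>\<omega>. cis (t * (W b \<omega> - W a \<omega>))) = complex_of_real (exp (- ((b - a) * t\<^sup>2 / 2)))"
proof -
  define \<sigma> where "\<sigma> = sqrt (b - a)"
  have \<sigma>: "0 < \<sigma>" "\<sigma>\<^sup>2 = b - a" using assms by (simp_all add: \<sigma>_def)
  have "distributed M lborel (\<lambda>\<omega>. W b \<omega> - W a \<omega>) (normal_density 0 \<sigma>)"
    unfolding \<sigma>_def using assms by (rule normal_increments)
  then have X: "distributed M lborel (\<lambda>\<omega>. (W b \<omega> - W a \<omega>) / \<sigma>) std_normal_density"
    using normal_standard_normal_convert[OF \<sigma>(1), of "\<lambda>\<omega>. W b \<omega> - W a \<omega>" 0] by simp
  have meas: "(\<lambda>\<omega>. (W b \<omega> - W a \<omega>) / \<sigma>) \<in> M \<rightarrow>\<^sub>M lborel"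
    using X by (rule distributed_measurable)
  have "complex_of_real (exp (- ((b - a) * t\<^sup>2 / 2))) = char std_normal_distribution (\<sigma> * t)"
    by (simp add: char_std_normal_distribution power_mult_distrib \<sigma>)
  also have "\<dots> = char (distr M lborel (\<lambda>\<omega>. (W b \<omega> - W a \<omega>) / \<sigma>)) (\<sigma> * t)"
    using distributed_distr_eq_density[OF X] by simp
  also have "\<dots> = expectation (\<lambda>\<omega>. iexp (\<sigma> * t * ((W b \<omega> - W a \<omega>) / \<sigma>)))"
    unfolding char_def by (subst integral_distr[OF meas]) auto
  also have "\<dots> = expectation (\<lambda>\<omega>. cis (t * (W b \<omega> - W a \<omega>)))"
    using \<sigma> by (intro Bochner_Integration.integral_cong) (simp_all add: cis_conv_exp)
  finally show ?thesis by simp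
qed

text \<open>Increments over cells of equal length are independent with a common law
  \<open>N\<close>, so their joint law is a power of \<open>N\<close>. Written through the
  increments, the sum is the one in \<open>phase_sum_mgf_le\<close> at its last step
  \<open>k = n\<close>.\<close>

lemma grid_phase_sum_mgf_le:
  fixes m \<beta> :: "nat \<Rightarrow> real"
  assumes n: "0 < n" and \<rho>: "\<rho> = exp (- (t\<^sup>2 / (2 * real n)))"
    and rec: "\<And>j. j < n \<Longrightarrow> \<beta> j = m j + \<rho> * \<beta> (Suc j)"
    and last: "\<beta> n = 0"
    and bound: "\<And>j. j < n \<Longrightarrow> cmod a * \<bar>\<beta> j\<bar> \<le> A"
  shows "(\<integral>\<^sup>+\<omega>. ennreal (exp (Re (a * (\<Sum>j<n. m j * cis (t * W (real (Suc j) / real n) \<omega>))))) \<partial>M)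
    \<le> ennreal (exp (Re a * \<rho> * \<beta> 0 + exp (2 * A) * (cmod a)\<^sup>2 * (1 - \<rho>\<^sup>2) * (\<Sum>j<n. (\<beta> j)\<^sup>2)))"
proof -
  define \<tau> where "\<tau> i = real i / real n" for i
  define X where "X i \<omega> = W (\<tau> (Suc i)) \<omega> - W (\<tau> i) \<omega>" for i \<omega>
  define N where "N = distr M borel (X 0)"
  define \<eta> where "\<eta> x = cis (t * x)" for x
  \<comment> \<open>The summand with \<open>\<beta> n\<close> is zero; keeping it makes
    \<open>F\<close> literally the integrand of \<open>phase_sum_mgf_le\<close>.\<close>
  define F where "F x = ennreal (exp (Re (a * ((\<Sum>j<n. m j * (\<Prod>i<Suc j. \<eta> (x i)))
      + \<rho> * \<beta> n * (\<Prod>i<n. \<eta> (x i))))))" for x :: "nat \<Rightarrow> real"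
  have \<tau>: "0 \<le> \<tau> i" "\<tau> i < \<tau> (Suc i)" "\<tau> (Suc i) - \<tau> i = 1 / real n" for i
    using n by (simp_all add: \<tau>_def divide_strict_right_mono diff_divide_distrib[symmetric])
  have X [measurable]: "X i \<in> borel_measurable M" for i
    unfolding X_def using random_variable \<tau> by (intro borel_measurable_diff) auto
  have \<eta> [measurable]: "\<eta> \<in> borel_measurable borel"
    unfolding \<eta>_def by (intro borel_measurable_continuous_onI continuous_intros)
  have law: "distr M borel (X i) = N" for i
  proof -
    have "distr M borel (X i) = density lborel (normal_density 0 (sqrt (1 / real n)))" for i
    proof -
      have "distributed M lborel (X i) (normal_density 0 (sqrt (1 / real n)))"
        unfolding X_def \<tau>(3)[of i, symmetric] using \<tau> by (intro normal_increments) auto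
      then have "distr M lborel (X i) = density lborel (normal_density 0 (sqrt (1 / real n)))"
        by (rule distributed_distr_eq_density)
      moreover have "distr M lborel (X i) = distr M borel (X i)"
        by (rule distr_cong) simp_all
      ultimately show ?thesis by simp
    qed
    then show ?thesis by (simp add: N_def)
  qed
  have N: "prob_space N" unfolding N_def by (rule prob_space_distr) simp
  have sets_N [measurable_cong]: "sets N = sets borel" by (simp add: N_def)
  have mean: "integral\<^sup>L N \<eta> = complex_of_real \<rho>"
  proof -
    have "integral\<^sup>L N \<eta> = expectation (\<lambda>\<omega>. cis (t * (W (\<tau> (Suc 0)) \<omega> - W (\<tau> 0) \<omega>)))"
      unfolding N_def by (subst integral_distr) (simp_all add: \<eta>_def X_def)
    also have "\<dots> = complex_of_real (exp (- ((\<tau> (Suc 0) - \<tau> 0) * t\<^sup>2 / 2)))"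
      using \<tau> by (intro expectation_cis_increment)
    also have "\<dots> = complex_of_real \<rho>" by (simp add: \<rho> \<tau>(3) mult_ac)
    finally show ?thesis .
  qed
  have [measurable]: "(\<lambda>x. \<eta> (x i)) \<in> borel_measurable (PiM I (\<lambda>_. borel))" if "i \<in> I" for i and I :: "nat set"
    using that by measurable
  have F: "F \<in> borel_measurable (PiM {..<n} (\<lambda>_. borel))"
    unfolding F_def
    by (intro measurable_compose[OF _ measurable_ennreal] measurable_compose[OF _ borel_measurable_exp]
          measurable_compose[OF _ borel_measurable_Re]
          borel_measurable_sum borel_measurable_times borel_measurable_add
          borel_measurable_const borel_measurable_prod) auto
  have "indep_vars (\<lambda>_. borel) X {..<n}"
    unfolding X_def using \<tau> by (intro indep_increments) auto
  then have joint: "distr M (PiM {..<n} (\<lambda>_. borel)) (\<lambda>\<omega>. \<lambda>i\<in>{..<n}. X i \<omega>) = PiM {..<n} (\<lambda>_. N)"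
    using n by (subst (asm) indep_vars_iff_distr_eq_PiM) (auto simp: law)
  have "(\<integral>\<^sup>+\<omega>. ennreal (exp (Re (a * (\<Sum>j<n. m j * cis (t * W (real (Suc j) / real n) \<omega>))))) \<partial>M)
      = (\<integral>\<^sup>+\<omega>. F (\<lambda>i\<in>{..<n}. X i \<omega>) \<partial>M)"
  proof (rule nn_integral_cong_AE)
    show "AE \<omega> in M. ennreal (exp (Re (a * (\<Sum>j<n. m j * cis (t * W (real (Suc j) / real n) \<omega>)))))
        = F (\<lambda>i\<in>{..<n}. X i \<omega>)"
      using start_zero
    proof eventually_elim
      case (elim \<omega>)
      have "cis (t * W (real (Suc j) / real n) \<omega>) = (\<Prod>i<Suc j. \<eta> ((\<lambda>i\<in>{..<n}. X i \<omega>) i))"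
        if "j < n" for j
      proof -
        \<comment> \<open>Telescoping recovers \<open>W\<close> only up to \<open>W 0\<close>, which
          vanishes almost surely; hence the equality of integrands is an almost sure one.\<close>
        have "(\<Sum>i<Suc j. X i \<omega>) = W (\<tau> (Suc j)) \<omega> - W (\<tau> 0) \<omega>"
          unfolding X_def by (rule sum_lessThan_telescope)
        then have "W (real (Suc j) / real n) \<omega> = (\<Sum>i<Suc j. X i \<omega>)"
          using elim unfolding \<tau>_def by simp
        then have "cis (t * W (real (Suc j) / real n) \<omega>) = (\<Prod>i<Suc j. \<eta> (X i \<omega>))"
          unfolding \<eta>_def by (simp only: sum_distrib_left cis_sum finite_lessThan)
        also have "\<dots> = (\<Prod>i<Suc j. \<eta> ((\<lambda>i\<in>{..<n}. X i \<omega>) i))"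
          using that by (intro prod.cong) auto
        finally show ?thesis .
      qed
      then have "(\<Sum>j<n. m j * cis (t * W (real (Suc j) / real n) \<omega>))
          = (\<Sum>j<n. m j * (\<Prod>i<Suc j. \<eta> ((\<lambda>i\<in>{..<n}. X i \<omega>) i)))"
        by (intro sum.cong arg_cong2[where f = "(*)"]) auto
      then show ?case
        by (simp only: F_def last mult_zero_left mult_zero_right of_real_0 add_0_right)
    qed
  qed
  also have "\<dots> = (\<integral>\<^sup>+x. F x \<partial>distr M (PiM {..<n} (\<lambda>_. borel)) (\<lambda>\<omega>. \<lambda>i\<in>{..<n}. X i \<omega>))"
    by (subst nn_integral_distr) (use F in auto)
  also have "\<dots> = (\<integral>\<^sup>+x. F x \<partial>PiM {..<n} (\<lambda>_. N))"
    by (simp add: joint)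
  also have "\<dots> \<le> ennreal (exp (Re a * \<rho> * \<beta> 0
      + exp (2 * A) * (cmod a)\<^sup>2 * (1 - \<rho>\<^sup>2) * (\<Sum>j<n. (\<beta> j)\<^sup>2)))"
    unfolding F_def
  proof (rule phase_sum_mgf_le[where n = n and \<eta> = \<eta>])
    show "\<eta> \<in> borel_measurable N" by measurable
    show "cmod (\<eta> x) = 1" for x by (simp add: \<eta>_def)
    show "\<beta> j = m j + \<rho> * \<beta> (Suc j)" "cmod a * \<bar>\<beta> j\<bar> \<le> A" if "j < n" for j
      using that by (fact rec, fact bound)
  qed (fact N mean order_refl)+
  finally show ?thesis .
qed

end

context frostman_measure
begin

text \<open>The grid sum is the integral of a step function that evaluates \<open>g\<close> at the
  right end of the cell containing \<open>u\<close>. Continuity gives pointwise convergence, and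
  dominated convergence applies because \<open>cmod (g u) \<le> 1\<close>. The argument
  \<open>max 0 u\<close> avoids negative times, where \<open>g\<close> need not be
  measurable.\<close>

lemma grid_sum_tendsto:
  fixes g :: "real \<Rightarrow> complex"
  assumes g: "continuous_on {0..} g" and g1: "\<And>u. cmod (g u) \<le> 1" and \<delta>: "0 < \<delta>"
  shows "(\<lambda>n. \<Sum>j<n. measure \<nu> (cell \<delta> n j) * g (real (Suc j) / real n))
    \<longlonglongrightarrow> (LINT u|\<nu>. indicator {\<delta><..} u *\<^sub>R g (max 0 u))"
proof -
  define f where "f n u = (\<Sum>j<n. indicator (cell \<delta> n j) u *\<^sub>R g (real (Suc j) / real n))" for n u
  have f_eq: "f n u = (if nat (\<lceil>real n * u\<rceil> - 1) < n
      then indicator {\<delta><..} u *\<^sub>R g (real (Suc (nat (\<lceil>real n * u\<rceil> - 1))) / real n) else 0)"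
    if "0 < n" for n u
  proof -
    have "f n u = (\<Sum>j<n. if nat (\<lceil>real n * u\<rceil> - 1) = j
        then indicator {\<delta><..} u *\<^sub>R g (real (Suc j) / real n) else 0)"
      unfolding f_def using that \<delta> by (intro sum.cong) (auto simp: indicator_cell)
    then show ?thesis by simp
  qed
  have gmeas: "(\<lambda>u. g (max 0 u)) \<in> borel_measurable borel"
    by (intro borel_measurable_continuous_onI continuous_on_compose2[OF g] continuous_intros) auto
  have "(\<lambda>n. LINT u|\<nu>. f n u) \<longlonglongrightarrow> (LINT u|\<nu>. indicator {\<delta><..} u *\<^sub>R g (max 0 u))"
  proof (rule integral_dominated_convergence[where w = "\<lambda>_. 1"])
    show "(\<lambda>u. indicator {\<delta><..} u *\<^sub>R g (max 0 u)) \<in> borel_measurable \<nu>"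
      using gmeas by measurable
    show "f n \<in> borel_measurable \<nu>" for n
      unfolding f_def by measurable
    show "AE u in \<nu>. cmod (f n u) \<le> 1" for n
    proof (intro AE_I2)
      fix u show "cmod (f n u) \<le> 1"
      proof (cases "n = 0")
        case False
        then show ?thesis using g1 by (simp add: f_eq indicator_def)
      qed (simp add: f_def)
    qed
    show "AE u in \<nu>. (\<lambda>n. f n u) \<longlonglongrightarrow> indicator {\<delta><..} u *\<^sub>R g (max 0 u)"
      using concentrated
    proof eventually_elim
      case (elim u)
      show ?case
      proof (cases "\<delta> < u")
        case True
        then have u: "0 < u" "u \<le> 1" using \<delta> elim by auto
        \<comment> \<open>The right end of the grid cell of \<open>u\<close>, at distance at most
          \<open>1 / n\<close> from \<open>u\<close>.\<close>
        define c where "c n = real (Suc (nat (\<lceil>real n * u\<rceil> - 1))) / real n" for n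
        have c: "u \<le> c n" "c n \<le> u + 1 / real n" and idx: "nat (\<lceil>real n * u\<rceil> - 1) < n" if "0 < n" for n
        proof -
          have "0 < real n * u" using u that by simp
          moreover have "real n * u \<le> real n" using u that by (simp add: mult_left_le)
          ultimately have *: "real n * u \<le> real (Suc (nat (\<lceil>real n * u\<rceil> - 1)))"
            "real (Suc (nat (\<lceil>real n * u\<rceil> - 1))) \<le> real n * u + 1" "nat (\<lceil>real n * u\<rceil> - 1) < n"
            by linarith+
          show "u \<le> c n" using *(1) that by (simp only: c_def) (simp add: field_simps)
          have "c n \<le> (real n * u + 1) / real n"
            unfolding c_def using *(2) by (rule divide_right_mono) simp
          also have "\<dots> = u + 1 / real n" using that by (simp add: field_simps)
          finally show "c n \<le> u + 1 / real n" .
          show "nat (\<lceil>real n * u\<rceil> - 1) < n" by fact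
        qed
        have "c \<longlonglongrightarrow> u"
        proof (rule tendsto_sandwich[where f = "\<lambda>_. u" and h = "\<lambda>n. u + 1 / real n"])
          show "(\<lambda>n. u + 1 / real n) \<longlonglongrightarrow> u"
            using tendsto_add[OF tendsto_const lim_1_over_n, of u] by simp
          show "\<forall>\<^sub>F n in sequentially. u \<le> c n" "\<forall>\<^sub>F n in sequentially. c n \<le> u + 1 / real n"
            using c by (auto intro: eventually_mono[OF eventually_gt_at_top[of 0]])
        qed simp
        then have "(\<lambda>n. g (c n)) \<longlonglongrightarrow> g u"
        proof (rule continuous_on_tendsto_compose[OF g])
          show "\<forall>\<^sub>F n in sequentially. c n \<in> {0..}" by (simp add: c_def)
        qed (use u in simp)
        moreover have "\<forall>\<^sub>F n in sequentially. g (c n) = f n u"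
          using eventually_gt_at_top[of 0]
          by eventually_elim (use True idx in \<open>simp add: f_eq c_def\<close>)
        ultimately show ?thesis
          using True u by (auto intro: Lim_transform_eventually)
      next
        case False
        have "\<forall>\<^sub>F n in sequentially. f n u = 0"
          using eventually_gt_at_top[of 0] by eventually_elim (use False in \<open>simp add: f_eq\<close>)
        then show ?thesis using False by (simp add: tendsto_eventually)
      qed
    qed
  qed simp_all
  moreover have "(LINT u|\<nu>. f n u) = (\<Sum>j<n. measure \<nu> (cell \<delta> n j) * g (real (Suc j) / real n))" for n
    unfolding f_def
    by (subst Bochner_Integration.integral_sum)
       (auto intro!: integrable_scaleR_left integrable_real_indicator
          simp: emeasure_eq_measure scaleR_conv_of_real)
  ultimately show ?thesis by simp
qed

end

section \<open>Uniform exponential moments of the truncated transform\<close>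

locale brownian_image = brownian_motion M W + mass: frostman_measure \<nu> s K
  for M :: "'w measure" and W :: "real \<Rightarrow> 'w \<Rightarrow> real" and \<nu> :: "real measure" and s K :: real
begin

definition grid_sum :: "nat \<Rightarrow> real \<Rightarrow> 'w \<Rightarrow> complex" where
  "grid_sum n R \<omega> = (\<Sum>j<n. measure \<nu> (mass.cell (1 / R\<^sup>2) n j)
      * cis (- 2 * pi * R * W (real (Suc j) / real n) \<omega>))"

definition truncated_transform :: "real \<Rightarrow> 'w \<Rightarrow> complex" where
  "truncated_transform R \<omega> = (LINT u|\<nu>. indicator {1 / R\<^sup>2<..} u *\<^sub>R cis (- 2 * pi * R * W (max 0 u) \<omega>))"

text \<open>The bound for \<open>R powr s * \<beta> j\<close>, that is, for the coefficients in the
  exponent after normalisation by \<open>R powr s\<close>.\<close>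

definition rate :: real where "rate = 2 * exp 1 * K"

text \<open>The product of the losses in the variance: 2 from
  \<open>discounted_sum_square_le\<close>, \<open>exp (2 * rate)\<close> from the quadratic bound,
  \<open>rate\<close> from the tail masses, and \<open>K * 2 powr s\<close> from
  \<open>sum_cell_power_le\<close>.\<close>

definition slope :: real where "slope = 2 * exp (2 * rate) * rate * K * 2 powr s"

lemma rate_nonneg: "0 \<le> rate" and slope_nonneg: "0 \<le> slope"
  using mass.K_nonneg by (simp_all add: rate_def slope_def)

text \<open>With \<open>cmod a = R powr s\<close> every power of \<open>R\<close> cancels:
  \<open>cmod a * \<beta> j\<close> is at most \<open>rate\<close>, and
  \<open>(cmod a)\<^sup>2 * \<delta> powr s = 1\<close> in the variance. Only the logarithm from
  \<open>sum_cell_power_le\<close> remains, uniformly in \<open>n\<close>.\<close>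

lemma grid_sum_mgf_le:
  assumes R: "1 \<le> R" and n: "R\<^sup>2 \<le> real n" and a: "cmod a = R powr s"
  shows "(\<integral>\<^sup>+\<omega>. ennreal (exp (Re (a * grid_sum n R \<omega>))) \<partial>M)
    \<le> ennreal (exp (rate + slope * (1 + log 2 (R\<^sup>2))))"
proof -
  define \<delta> where "\<delta> = 1 / R\<^sup>2"
  define \<rho> where "\<rho> = exp (- ((- 2 * pi * R)\<^sup>2 / (2 * real n)))"
  define m where "m j = measure \<nu> (mass.cell \<delta> n j)" for j
  define \<beta> where "\<beta> = mass.tail_mass \<delta> n \<rho>"
  have \<delta>: "0 < \<delta>" "\<delta> = 1 / R\<^sup>2" using R by (simp_all add: \<delta>_def)
  have \<delta>_powr: "\<delta> powr (s / 2) = R powr (- s)"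
  proof -
    have "\<delta> = R powr (- 2)" using R by (simp add: \<delta>_def powr_minus divide_simps)
    then show ?thesis by (simp add: powr_powr)
  qed
  have n0: "0 < n" using R n by (metis less_le_trans of_nat_0_less_iff one_le_power zero_less_one)
  have \<rho>0: "0 \<le> \<rho>" "\<rho> \<le> 1" by (simp_all add: \<rho>_def)
  have \<rho>1: "\<rho> \<le> exp (- (R\<^sup>2 / real n))"
  proof -
    \<comment> \<open>The exponent of \<rho> is \<open>- 2 * pi\<^sup>2 * R\<^sup>2 / n\<close>,
      which leaves room to spare for the decay demanded by \<open>tail_mass_le\<close>.\<close>
    have "1 * (2 * R\<^sup>2) \<le> pi\<^sup>2 * (4 * R\<^sup>2)"
      using pi_ge_two by (intro mult_mono) (auto intro: one_le_power)
    then have "R\<^sup>2 / real n \<le> (- 2 * pi * R)\<^sup>2 / (2 * real n)"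
      using n0 by (simp add: power_mult_distrib divide_simps)
    then show ?thesis by (simp add: \<rho>_def)
  qed
  have \<beta>_nonneg: "0 \<le> \<beta> j" for j unfolding \<beta>_def by (rule mass.tail_mass_nonneg[OF \<rho>0(1)])
  have \<beta>_le: "\<beta> j \<le> rate * max \<delta> (real j / real n) powr (- s / 2) * \<delta> powr s" for j
    unfolding \<beta>_def rate_def by (rule mass.tail_mass_le[OF R n \<rho>0(1) \<rho>1 \<delta>(2)])
  have \<beta>_le': "cmod a * \<beta> j \<le> rate" for j
  proof -
    \<comment> \<open>The singular weight is largest at the cut-off \<delta>, where the tail bound
      becomes \<open>rate * \<delta> powr (s / 2) = rate * R powr (- s)\<close>.\<close>
    have "max \<delta> (real j / real n) powr (- s / 2) \<le> \<delta> powr (- s / 2)"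
      using \<delta> mass.s_pos by (intro powr_mono2') auto
    then have "\<beta> j \<le> rate * \<delta> powr (- s / 2) * \<delta> powr s"
      using rate_nonneg by (intro order_trans[OF \<beta>_le] mult_right_mono mult_left_mono) auto
    also have "\<dots> = rate * \<delta> powr (s / 2)"
      by (simp add: powr_add[symmetric])
    finally have "cmod a * \<beta> j \<le> R powr s * (rate * \<delta> powr (s / 2))"
      unfolding a by (rule mult_left_mono) simp
    also have "\<dots> = rate"
      using R by (simp add: \<delta>_powr powr_minus)
    finally show ?thesis .
  qed
  have rec: "\<beta> j = m j + \<rho> * \<beta> (Suc j)" if "j < n" for j
    unfolding \<beta>_def m_def using that by (rule mass.tail_mass_rec)
  have last: "\<beta> n = 0" by (simp add: \<beta>_def mass.tail_mass_def)
  have "(\<integral>\<^sup>+\<omega>. ennreal (exp (Re (a * grid_sum n R \<omega>))) \<partial>M)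
      \<le> ennreal (exp (Re a * \<rho> * \<beta> 0 + exp (2 * rate) * (cmod a)\<^sup>2 * (1 - \<rho>\<^sup>2) * (\<Sum>j<n. (\<beta> j)\<^sup>2)))"
    unfolding grid_sum_def \<delta>_def[symmetric] m_def[symmetric]
    using \<beta>_le' \<beta>_nonneg by (intro grid_phase_sum_mgf_le n0 \<rho>_def rec last) auto
  also have "\<dots> \<le> ennreal (exp (rate + slope * (1 + log 2 (R\<^sup>2))))"
  proof (rule ennreal_leI, simp only: exp_le_cancel_iff, rule add_mono)
    have "Re a * \<rho> * \<beta> 0 \<le> cmod a * 1 * \<beta> 0"
      using \<rho>0 \<beta>_nonneg complex_Re_le_cmod[of a] by (intro mult_right_mono mult_mono) auto
    then show "Re a * \<rho> * \<beta> 0 \<le> rate" using \<beta>_le'[of 0] by simp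
    have "(1 - \<rho>\<^sup>2) * (\<Sum>j<n. (\<beta> j)\<^sup>2) \<le> 2 * (\<Sum>j<n. m j * \<beta> j)"
      by (rule discounted_sum_square_le) (use rec last \<beta>_nonneg \<rho>0 in \<open>auto simp: m_def\<close>)
    also have "(\<Sum>j<n. m j * \<beta> j)
        \<le> (\<Sum>j<n. m j * (rate * max \<delta> (real j / real n) powr (- s / 2) * \<delta> powr s))"
      by (intro sum_mono mult_left_mono \<beta>_le) (simp add: m_def)
    also have "\<dots> = rate * \<delta> powr s * (\<Sum>j<n. m j * max \<delta> (real j / real n) powr (- s / 2))"
      by (simp add: sum_distrib_left mult_ac)
    also have "\<dots> \<le> rate * \<delta> powr s * (K * 2 powr s * (1 + log 2 (R\<^sup>2)))"
      unfolding m_def using rate_nonneg by (intro mult_left_mono mass.sum_cell_power_le R n \<delta>) auto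
    finally have "(1 - \<rho>\<^sup>2) * (\<Sum>j<n. (\<beta> j)\<^sup>2) \<le> 2 * (rate * \<delta> powr s * (K * 2 powr s * (1 + log 2 (R\<^sup>2))))"
      by simp
    then have "exp (2 * rate) * (cmod a)\<^sup>2 * ((1 - \<rho>\<^sup>2) * (\<Sum>j<n. (\<beta> j)\<^sup>2))
        \<le> exp (2 * rate) * (cmod a)\<^sup>2 * (2 * (rate * \<delta> powr s * (K * 2 powr s * (1 + log 2 (R\<^sup>2)))))"
      by (rule mult_left_mono) simp
    also have "\<dots> = slope * (1 + log 2 (R\<^sup>2)) * ((cmod a)\<^sup>2 * \<delta> powr s)"
      by (simp add: slope_def mult_ac)
    also have "(cmod a)\<^sup>2 * \<delta> powr s = 1"
    proof -
      have "\<delta> powr s = (\<delta> powr (s / 2))\<^sup>2" by (simp add: power2_eq_square powr_add[symmetric])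
      then show ?thesis using R by (simp add: a \<delta>_powr powr_minus power_inverse field_simps)
    qed
    finally show "exp (2 * rate) * (cmod a)\<^sup>2 * (1 - \<rho>\<^sup>2) * (\<Sum>j<n. (\<beta> j)\<^sup>2) \<le> slope * (1 + log 2 (R\<^sup>2))"
      by (simp add: mult.assoc)
  qed
  finally show ?thesis .
qed

lemma grid_sum_measurable [measurable]: "grid_sum n R \<in> borel_measurable M"
proof -
  have "(\<lambda>\<omega>. cis (- 2 * pi * R * W (real (Suc j) / real n) \<omega>)) \<in> borel_measurable M" for j
  proof (rule measurable_compose[of "W (real (Suc j) / real n)" M borel])
    show "W (real (Suc j) / real n) \<in> borel_measurable M" by (rule random_variable) simp
    show "(\<lambda>x. cis (- 2 * pi * R * x)) \<in> borel_measurable borel"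
      by (intro borel_measurable_continuous_onI continuous_intros)
  qed
  then show ?thesis unfolding grid_sum_def by (intro borel_measurable_sum borel_measurable_times) auto
qed

lemma grid_sum_tendsto_truncated:
  assumes "continuous_on {0..} (\<lambda>t. W t \<omega>)" "0 < R"
  shows "(\<lambda>n. grid_sum n R \<omega>) \<longlonglongrightarrow> truncated_transform R \<omega>"
  unfolding grid_sum_def truncated_transform_def
  using assms by (intro mass.grid_sum_tendsto[where g = "\<lambda>t. cis (- 2 * pi * R * W t \<omega>)"] continuous_intros) auto

text \<open>
  Defined through the grid sums because \<^term>\<open>truncated_transform R\<close> need not be measurable in
  \<open>\<omega>\<close>: the paths are continuous only almost surely.
\<close>

definition exp_moment :: "complex \<Rightarrow> real \<Rightarrow> 'w \<Rightarrow> ennreal" where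
  "exp_moment a R \<omega> = liminf (\<lambda>n. ennreal (exp (Re (a * grid_sum n R \<omega>))))"

lemma exp_moment_measurable [measurable]: "exp_moment a R \<in> borel_measurable M"
  unfolding exp_moment_def by measurable

lemma exp_moment_eq:
  assumes "continuous_on {0..} (\<lambda>t. W t \<omega>)" "0 < R"
  shows "exp_moment a R \<omega> = ennreal (exp (Re (a * truncated_transform R \<omega>)))"
  unfolding exp_moment_def
  by (intro lim_imp_Liminf tendsto_intros grid_sum_tendsto_truncated assms) simp

text \<open>Fatou's lemma; the grid estimate is available as soon as \<open>n\<close> is at least
  \<open>R\<^sup>2\<close>.\<close>

lemma nn_integral_exp_moment_le:
  assumes "1 \<le> R" "cmod a = R powr s"
  shows "(\<integral>\<^sup>+\<omega>. exp_moment a R \<omega> \<partial>M) \<le> ennreal (exp (rate + slope * (1 + log 2 (R\<^sup>2))))"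
proof -
  have "(\<integral>\<^sup>+\<omega>. exp_moment a R \<omega> \<partial>M)
      \<le> liminf (\<lambda>n. \<integral>\<^sup>+\<omega>. ennreal (exp (Re (a * grid_sum n R \<omega>))) \<partial>M)"
    unfolding exp_moment_def by (rule nn_integral_liminf) measurable
  also have "\<dots> \<le> ennreal (exp (rate + slope * (1 + log 2 (R\<^sup>2))))"
  proof (rule Liminf_le)
    show "\<forall>\<^sub>F n in sequentially. (\<integral>\<^sup>+\<omega>. ennreal (exp (Re (a * grid_sum n R \<omega>))) \<partial>M)
        \<le> ennreal (exp (rate + slope * (1 + log 2 (R\<^sup>2))))"
      using eventually_ge_at_top[of "nat \<lceil>R\<^sup>2\<rceil>"]
      by eventually_elim (intro grid_sum_mgf_le assms, linarith)
  qed simp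
  finally show ?thesis .
qed

section \<open>Almost sure decay along the sample frequencies\<close>

definition sample_point :: "nat \<Rightarrow> real" where
  "sample_point k = real (Suc k) powr (1 / (1 + s))"

lemma sample_point_ge_1: "1 \<le> sample_point k"
  using mass.s_pos by (simp add: sample_point_def ge_one_powr_ge_zero)

text \<open>The exponential moments, weighted and summed over all samples and four directions, have
  finite expectation, so the sum is almost surely finite. It dominates each of its terms, and taking
  logarithms turns this into the pointwise bound. This plays the part of a Borel-Cantelli
  argument.\<close>

lemma AE_truncated_transform_bound:
  "AE \<omega> in M. \<exists>C\<ge>0. \<forall>k. cmod (truncated_transform (sample_point k) \<omega>)
     \<le> C * sample_point k powr (- s) * (1 + ln (sample_point k))"
proof -
  \<comment> \<open>Converts the binary logarithm of \<open>(r k)\<^sup>2\<close> into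
    \<open>c * ln (r k)\<close>.\<close>
  define c where "c = 2 / ln (2 :: real)"
  \<comment> \<open>The first three summands absorb the polynomial growth of the moments; the last
    leaves the summable factor \<open>(k + 1)\<close> to the power -2, because
    \<open>(1 + s) * ln (r k) = ln (k + 1)\<close>.\<close>
  define E where "E = rate + slope + c * slope + 2 * (1 + s)"
  define r where "r = sample_point"
  \<comment> \<open>Upper bounds on the real part in these four directions bound the absolute values
    of both the real and the imaginary part.\<close>
  define A where "A = {1, - 1, \<i>, - \<i>}"
  define w where "w k = exp (- E * (1 + ln (r k)))" for k
  define f where "f k \<omega> = (\<Sum>c\<in>A. ennreal (w k) * exp_moment (r k powr s * c) (r k) \<omega>)" for k \<omega>
  have A: "finite A" "card A = 4" and A1: "\<And>c. c \<in> A \<Longrightarrow> cmod c = 1"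
  proof -
    show "finite A" "card A = 4" by (simp_all add: A_def complex_eq_iff)
    show "cmod c = 1" if "c \<in> A" for c using that unfolding A_def by auto
  qed
  have r1: "1 \<le> r k" for k unfolding r_def by (rule sample_point_ge_1)
  then have r0: "0 < r k" for k by (rule less_le_trans[OF zero_less_one])
  have c0: "0 \<le> c" by (simp add: c_def)
  have E0: "0 \<le> E" unfolding E_def using c0 rate_nonneg slope_nonneg mass.s_pos by simp
  have f_meas [measurable]: "f k \<in> borel_measurable M" for k unfolding f_def by measurable
  have weight: "w k * exp (rate + slope * (1 + log 2 ((r k)\<^sup>2))) \<le> inverse (real (Suc k) ^ 2)" for k
  proof -
    have lr: "0 \<le> ln (r k)" using r1 by simp
    have "log 2 ((r k)\<^sup>2) = c * ln (r k)"
      using r0 by (simp add: c_def log_def ln_realpow)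
    then have "- E * (1 + ln (r k)) + (rate + slope * (1 + log 2 ((r k)\<^sup>2)))
       = - (c * slope + 2 * (1 + s)) - (rate + slope) * ln (r k) - 2 * (1 + s) * ln (r k)"
      by (simp add: E_def algebra_simps)
    also have "\<dots> \<le> - (2 * (1 + s) * ln (r k))"
    proof -
      have "0 \<le> c * slope" "0 \<le> (rate + slope) * ln (r k)"
        using c0 lr rate_nonneg slope_nonneg by simp_all
      moreover have "- (x + y) - z - t \<le> - t" if "0 \<le> x" "0 \<le> y" "0 \<le> z" for x y z t :: real
        using that by simp
      ultimately show ?thesis using mass.s_pos by simp
    qed
    also have "\<dots> = - 2 * ln (real (Suc k))"
    proof -
      have "ln (r k) = ln (real (Suc k)) / (1 + s)" by (simp add: r_def sample_point_def ln_powr)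
      then have "(1 + s) * ln (r k) = ln (real (Suc k))" using mass.s_pos by simp
      then show ?thesis by (simp only: mult.assoc)
    qed
    finally have "w k * exp (rate + slope * (1 + log 2 ((r k)\<^sup>2))) \<le> exp (- 2 * ln (real (Suc k)))"
      unfolding w_def exp_add[symmetric] by simp
    also have "\<dots> = inverse (real (Suc k) ^ 2)"
      by (simp add: exp_minus exp_double)
    finally show ?thesis .
  qed
  have "(\<integral>\<^sup>+\<omega>. (\<Sum>k. f k \<omega>) \<partial>M) = (\<Sum>k. \<integral>\<^sup>+\<omega>. f k \<omega> \<partial>M)"
    by (rule nn_integral_suminf) measurable
  also have "\<dots> \<le> (\<Sum>k. ennreal (4 * inverse (real (Suc k) ^ 2)))"
  proof (intro suminf_le)
    fix k
    have "(\<integral>\<^sup>+\<omega>. f k \<omega> \<partial>M) = (\<Sum>c\<in>A. ennreal (w k) * (\<integral>\<^sup>+\<omega>. exp_moment (r k powr s * c) (r k) \<omega> \<partial>M))"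
      unfolding f_def by (subst nn_integral_sum) (auto intro!: sum.cong nn_integral_cmult)
    also have "\<dots> \<le> (\<Sum>c\<in>A. ennreal (w k) * ennreal (exp (rate + slope * (1 + log 2 ((r k)\<^sup>2)))))"
      by (intro sum_mono mult_left_mono nn_integral_exp_moment_le r1) (simp_all add: norm_mult A1)
    also have "\<dots> \<le> (\<Sum>c\<in>A. ennreal (inverse (real (Suc k) ^ 2)))"
      using weight by (intro sum_mono) (simp add: ennreal_mult[symmetric] w_def ennreal_leI)
    also have "\<dots> = ennreal (4 * inverse (real (Suc k) ^ 2))"
      using A by (simp add: ennreal_mult)
    finally show "(\<integral>\<^sup>+\<omega>. f k \<omega> \<partial>M) \<le> ennreal (4 * inverse (real (Suc k) ^ 2))" .
  qed simp_all
  also have "\<dots> < \<infinity>"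
  proof -
    have "summable (\<lambda>k. 4 * inverse (real (Suc k) ^ 2))"
      using inverse_power_summable[of 2, where 'a = real]
      by (intro summable_mult) (subst summable_Suc_iff[where f = "\<lambda>k. inverse (real k ^ 2)"], simp)
    then show ?thesis by (subst suminf_ennreal2) auto
  qed
  finally have "AE \<omega> in M. (\<Sum>k. f k \<omega>) \<noteq> \<infinity>"
    by (intro nn_integral_PInf_AE) auto
  then show ?thesis
    using continuous_paths
  proof eventually_elim
    case (elim \<omega>)
    obtain S where S: "(\<Sum>k. f k \<omega>) = ennreal S" "0 \<le> S"
      using elim(1) by (cases "\<Sum>k. f k \<omega>") auto
    \<comment> \<open>Each term satisfies \<open>w k * exp x \<le> S\<close>. Passing to
      \<open>1 + S\<close> keeps the logarithm defined and nonnegative even for small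
      \<open>S\<close>.\<close>
    define B where "B = ln (1 + S) + E"
    have B0: "0 \<le> B" using S E0 by (simp add: B_def)
    have bound: "r k powr s * Re (c * truncated_transform (r k) \<omega>) \<le> B * (1 + ln (r k))" if c: "c \<in> A" for c k
    proof -
      define x where "x = r k powr s * Re (c * truncated_transform (r k) \<omega>)"
      have lr: "0 \<le> ln (r k)" using r1 by simp
      have "ennreal (w k * exp x) = ennreal (w k) * exp_moment (r k powr s * c) (r k) \<omega>"
        by (subst exp_moment_eq[OF elim(2) r0]) (simp add: ennreal_mult w_def x_def mult.assoc)
      also have "\<dots> \<le> f k \<omega>"
        unfolding f_def by (rule member_le_sum[OF c]) (use A in auto)
      also have "f k \<omega> \<le> (\<Sum>k. f k \<omega>)"
        using sum_le_suminf[of "\<lambda>k. f k \<omega>" "{k}"] by simp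
      finally have "w k * exp x \<le> S" using S by (simp add: ennreal_le_iff)
      then have "exp (- E * (1 + ln (r k)) + x) \<le> exp (ln (1 + S))"
        using S unfolding w_def exp_add by simp
      then have "x \<le> ln (1 + S) + E * (1 + ln (r k))" by simp
      also have "\<dots> \<le> ln (1 + S) * (1 + ln (r k)) + E * (1 + ln (r k))"
        using S lr by (simp add: mult_le_cancel_left1)
      finally show ?thesis by (simp add: B_def x_def algebra_simps)
    qed
    have "cmod (truncated_transform (r k) \<omega>) \<le> 2 * B * r k powr (- s) * (1 + ln (r k))" for k
    proof -
      define z where "z = truncated_transform (r k) \<omega>"
      have "r k powr s * \<bar>Re z\<bar> \<le> B * (1 + ln (r k))"
        using bound[of 1 k] bound[of "- 1" k] by (auto simp: A_def z_def abs_if)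
      moreover have "r k powr s * \<bar>Im z\<bar> \<le> B * (1 + ln (r k))"
        using bound[of "\<i>" k] bound[of "- \<i>" k] by (auto simp: A_def z_def abs_if)
      ultimately have "r k powr s * cmod z \<le> 2 * B * (1 + ln (r k))"
        using mult_left_mono[OF cmod_le[of z], of "r k powr s"] by (simp add: distrib_left)
      then show ?thesis using r0[of k] by (simp add: z_def powr_minus field_simps)
    qed
    then show ?case unfolding r_def using B0 by (intro exI[of _ "2 * B"]) auto
  qed
qed

end

section \<open>From sample frequencies to all frequencies\<close>

text \<open>The nearest sample \<open>r\<close> below \<xi> is within \<open>r powr (- s)\<close> of
  it, so the Lipschitz error has the order of the claimed decay. The factor \<open>2 powr s\<close>
  comes from \<open>\<xi> / 2 \<le> r\<close>, while 3 and 2 come from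
  \<open>1 + ln r \<le> 3 * ln \<xi>\<close> and \<open>1 \<le> 2 * ln \<xi>\<close>.\<close>

lemma decay_of_decay_at_samples:
  fixes F :: "real \<Rightarrow> complex"
  assumes s: "0 < s" and C: "0 \<le> C" and L: "0 \<le> L"
    and lipschitz: "\<And>x y. cmod (F x - F y) \<le> L * \<bar>x - y\<bar>"
    and samples: "\<And>k. cmod (F (real (Suc k) powr (1 / (1 + s))))
      \<le> C * (real (Suc k) powr (1 / (1 + s))) powr (- s) * (1 + ln (real (Suc k) powr (1 / (1 + s))))"
    and \<xi>: "2 \<le> \<xi>"
  shows "cmod (F \<xi>) \<le> (3 * C + 2 * L) * 2 powr s * \<xi> powr (- s) * ln \<xi>"
proof -
  define p where "p = 1 / (1 + s)"
  define y where "y = \<xi> powr (1 + s)"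
  \<comment> \<open>Since \<open>y powr p = \<xi>\<close>, rounding \<open>y\<close> down gives the
    largest sample frequency \<open>r\<close> not exceeding \<xi>; \<xi> \<ge> 2 ensures that such a
    sample exists.\<close>
  define q where "q = real (nat \<lfloor>y\<rfloor>)"
  define r where "r = q powr p"
  have p: "0 < p" "p \<le> 1" "(1 + s) * p = 1" "p - 1 = p * (- s)"
    using s by (simp_all add: p_def field_simps)
  have "1 \<le> y" unfolding y_def using \<xi> s by (intro ge_one_powr_ge_zero) auto
  then have "1 \<le> \<lfloor>y\<rfloor>" by simp
  then have "q = of_int \<lfloor>y\<rfloor>" by (simp add: q_def)
  then have q: "1 \<le> q" "q \<le> y" "y \<le> q + 1" using \<open>1 \<le> \<lfloor>y\<rfloor>\<close> by linarith+
  have yp: "y powr p = \<xi>" using \<xi> p by (simp add: y_def powr_powr)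
  have r1: "1 \<le> r" unfolding r_def using q p by (intro ge_one_powr_ge_zero) auto
  have r_le: "r \<le> \<xi>" unfolding r_def yp[symmetric] using q p by (intro powr_mono2) auto
  have "\<xi> \<le> (q + 1) powr p" unfolding yp[symmetric] using q p \<open>1 \<le> y\<close> by (intro powr_mono2) auto
  also have "q + 1 = q * (1 + 1 / q)" using q by (simp add: field_simps)
  also have "(q * (1 + 1 / q)) powr p = r * (1 + 1 / q) powr p" using q by (simp add: r_def powr_mult)
  \<comment> \<open>As \<xi> is at most the next sample and \<open>p \<le> 1\<close>, the gap is at
    most \<open>r / q\<close>, which equals \<open>r powr (- s)\<close> by the choice of
    \<open>p\<close>.\<close>
  also have "\<dots> \<le> r * (1 + 1 / q) powr 1"
    using q p r1 by (intro mult_left_mono powr_mono) auto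
  also have "\<dots> = r + r / q" using q by (simp add: field_simps)
  finally have gap: "\<xi> \<le> r + r / q" .
  have "r / q = q powr (p - 1)" using q by (simp add: r_def powr_diff)
  also have "\<dots> = r powr (- s)" unfolding p(4) r_def by (simp add: powr_powr)
  finally have rq: "r / q = r powr (- s)" .
  have "r / q \<le> r / 1" using q r1 by (intro divide_left_mono) auto
  then have "\<xi> / 2 \<le> r" using gap by simp
  then have "r powr (- s) \<le> (\<xi> / 2) powr (- s)" using \<xi> s by (intro powr_mono2') auto
  then have r_powr: "r powr (- s) \<le> 2 powr s * \<xi> powr (- s)"
    using \<xi> by (simp add: powr_divide powr_minus field_simps)
  have "ln 2 \<le> ln \<xi>" using \<xi> by simp
  then have ln_ge: "1 / 2 \<le> ln \<xi>" using ln2_ge_two_thirds by simp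
  have "ln r \<le> ln \<xi>" using r1 r_le by simp
  then have ln_le: "1 + ln r \<le> 3 * ln \<xi>" using ln_ge by simp
  have "\<exists>k. q = real (Suc k)" using q(1) unfolding q_def
    by (metis One_nat_def Suc_le_D of_nat_1 of_nat_le_iff)
  then have "cmod (F r) \<le> C * r powr (- s) * (1 + ln r)"
    using samples unfolding r_def p_def by auto
  also have "\<dots> \<le> C * r powr (- s) * (3 * ln \<xi>)"
    using C ln_le by (intro mult_left_mono) auto
  finally have Fr: "cmod (F r) \<le> C * r powr (- s) * (3 * ln \<xi>)" .
  have "cmod (F \<xi> - F r) \<le> L * r powr (- s)"
    using gap r_le rq L by (intro order_trans[OF lipschitz] mult_left_mono) auto
  also have "\<dots> \<le> L * r powr (- s) * (2 * ln \<xi>)"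
    using mult_left_mono[of 1 "2 * ln \<xi>" "L * r powr (- s)"] L ln_ge by simp
  finally have "cmod (F \<xi>) \<le> C * r powr (- s) * (3 * ln \<xi>) + L * r powr (- s) * (2 * ln \<xi>)"
    using Fr norm_triangle_sub[of "F \<xi>" "F r"] by simp
  also have "\<dots> = (3 * C + 2 * L) * ln \<xi> * r powr (- s)" by (simp add: algebra_simps)
  also have "\<dots> \<le> (3 * C + 2 * L) * ln \<xi> * (2 powr s * \<xi> powr (- s))"
    using C L ln_ge by (intro mult_left_mono r_powr) auto
  finally show ?thesis by (simp add: mult_ac)
qed

lemma norm_cis_diff_le: "cmod (cis x - cis y) \<le> \<bar>x - y\<bar>"
proof -
  have "cis x - cis y = cis y * (cis (x - y) - 1)"
    by (simp add: cis_mult right_diff_distrib)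
  then have "cmod (cis x - cis y) = cmod (exp (\<i> * complex_of_real (x - y)) - 1)"
    by (simp add: norm_mult cis_conv_exp)
  also have "\<dots> = 2 * \<bar>sin ((x - y) / 2)\<bar>" by (rule dist_exp_i_1)
  also have "\<dots> \<le> \<bar>x - y\<bar>" using abs_sin_x_le_abs_x[of "(x - y) / 2"] by simp
  finally show ?thesis .
qed

section \<open>Truncation error, Lipschitz bound and symmetry of the full transform\<close>

context brownian_image
begin

text \<open>The Fourier transform of the image measure pulled back to an integral over time. The
  argument \<open>max 0 u\<close> makes the integrand Borel on the whole line when the path is
  continuous on nonnegative times.\<close>

definition image_transform :: "'w \<Rightarrow> real \<Rightarrow> complex" where
  "image_transform \<omega> \<xi> = (LINT u|\<nu>. cis (- 2 * pi * \<xi> * W (max 0 u) \<omega>))"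

context
  fixes \<omega>
  assumes path: "continuous_on {0..} (\<lambda>t. W t \<omega>)"
begin

lemma borel_measurable_path: "(\<lambda>u. W (max 0 u) \<omega>) \<in> borel_measurable borel"
  by (intro borel_measurable_continuous_onI continuous_on_compose2[OF path] continuous_intros) auto

lemma borel_measurable_phase [measurable]:
  "(\<lambda>u. cis (- 2 * pi * \<xi> * W (max 0 u) \<omega>)) \<in> borel_measurable borel"
  by (rule measurable_compose[OF borel_measurable_path])
     (intro borel_measurable_continuous_onI continuous_intros)

lemma integrable_phase: "integrable \<nu> (\<lambda>u. cis (- 2 * pi * \<xi> * W (max 0 u) \<omega>))"
proof (rule mass.integrable_const_bound[where B = 1])
  show "(\<lambda>u. cis (- 2 * pi * \<xi> * W (max 0 u) \<omega>)) \<in> borel_measurable \<nu>" by measurable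
qed simp

text \<open>The discarded integrand has modulus 1, so the error is at most the mass of the times up
  to \<open>1 / R\<^sup>2\<close>, to which the bound at the origin applies.\<close>

lemma image_transform_truncation_error:
  assumes "0 < R"
  shows "cmod (image_transform \<omega> R - truncated_transform R \<omega>) \<le> K * R powr (- s)"
proof -
  define f where "f u = cis (- 2 * pi * R * W (max 0 u) \<omega>)" for u
  have f [measurable]: "f \<in> borel_measurable borel" unfolding f_def by measurable
  have int: "integrable \<nu> f" unfolding f_def by (rule integrable_phase)
  have int': "integrable \<nu> (\<lambda>u. indicator {1 / R\<^sup>2<..} u *\<^sub>R f u)"
  proof (rule mass.integrable_const_bound[where B = 1])
    show "AE u in \<nu>. cmod (indicator {1 / R\<^sup>2<..} u *\<^sub>R f u) \<le> 1"
      by (auto simp: f_def indicator_def)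
  qed measurable
  have "image_transform \<omega> R - truncated_transform R \<omega> = (LINT u|\<nu>. f u - indicator {1 / R\<^sup>2<..} u *\<^sub>R f u)"
    unfolding image_transform_def truncated_transform_def f_def[symmetric]
    using int int' by simp
  also have "cmod \<dots> \<le> (LINT u|\<nu>. cmod (f u - indicator {1 / R\<^sup>2<..} u *\<^sub>R f u))"
    by (rule integral_norm_bound)
  also have "\<dots> = (LINT u|\<nu>. indicator {0..1 / R\<^sup>2} u)"
  proof (rule integral_cong_AE)
    show "AE u in \<nu>. cmod (f u - indicator {1 / R\<^sup>2<..} u *\<^sub>R f u) = indicator {0..1 / R\<^sup>2} u"
      using mass.concentrated by eventually_elim (auto simp: f_def indicator_def)
  qed measurable
  also have "\<dots> = measure \<nu> {0..1 / R\<^sup>2}" by simp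
  also have "\<dots> \<le> K * (1 / R\<^sup>2) powr (s / 2)"
    using assms by (intro mass.measure_origin_le) simp
  also have "(1 / R\<^sup>2) powr (s / 2) = R powr (- s)"
  proof -
    have "1 / R\<^sup>2 = R powr (- 2)" using assms by (simp add: powr_minus divide_simps)
    then show ?thesis by (simp add: powr_powr)
  qed
  finally show ?thesis .
qed

text \<open>The constant depends on the path through its maximum \<open>B\<close> on the compact
  unit interval, where the measure is concentrated.\<close>

lemma image_transform_lipschitz:
  obtains L where "0 \<le> L" "\<And>\<xi> \<xi>'. cmod (image_transform \<omega> \<xi> - image_transform \<omega> \<xi>') \<le> L * \<bar>\<xi> - \<xi>'\<bar>"
proof -
  have "compact ((\<lambda>t. W t \<omega>) ` {0..1})"
    by (intro compact_continuous_image continuous_on_subset[OF path]) auto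
  then obtain B where B: "\<And>t. 0 \<le> t \<Longrightarrow> t \<le> 1 \<Longrightarrow> \<bar>W t \<omega>\<bar> \<le> B"
    by (force dest!: compact_imp_bounded simp: bounded_iff)
  have B0: "0 \<le> B" using B[of 0] by simp
  have "cmod (image_transform \<omega> \<xi> - image_transform \<omega> \<xi>') \<le> (2 * pi * B * measure \<nu> UNIV) * \<bar>\<xi> - \<xi>'\<bar>" for \<xi> \<xi>'
  proof -
    define D where "D u = cis (- 2 * pi * \<xi> * W (max 0 u) \<omega>) - cis (- 2 * pi * \<xi>' * W (max 0 u) \<omega>)" for u
    have D: "integrable \<nu> D" unfolding D_def by (intro Bochner_Integration.integrable_diff integrable_phase)
    have "image_transform \<omega> \<xi> - image_transform \<omega> \<xi>' = (LINT u|\<nu>. D u)"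
      unfolding image_transform_def D_def
      by (rule Bochner_Integration.integral_diff[symmetric]) (rule integrable_phase)+
    also have "cmod \<dots> \<le> (LINT u|\<nu>. cmod (D u))" by (rule integral_norm_bound)
    also have "\<dots> \<le> (LINT u|\<nu>. 2 * pi * B * \<bar>\<xi> - \<xi>'\<bar>)"
    proof (rule integral_mono_AE)
      show "AE u in \<nu>. cmod (D u) \<le> 2 * pi * B * \<bar>\<xi> - \<xi>'\<bar>"
        using mass.concentrated
      proof eventually_elim
        case (elim u)
        have "cmod (D u) \<le> \<bar>- 2 * pi * \<xi> * W (max 0 u) \<omega> - - 2 * pi * \<xi>' * W (max 0 u) \<omega>\<bar>"
          unfolding D_def by (rule norm_cis_diff_le)
        also have "- 2 * pi * \<xi> * W (max 0 u) \<omega> - - 2 * pi * \<xi>' * W (max 0 u) \<omega>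
            = (2 * pi * W (max 0 u) \<omega>) * (\<xi>' - \<xi>)"
          by (simp add: algebra_simps)
        also have "\<bar>\<dots>\<bar> = (2 * pi * \<bar>W (max 0 u) \<omega>\<bar>) * \<bar>\<xi> - \<xi>'\<bar>"
          by (simp add: abs_mult abs_minus_commute)
        also have "\<dots> \<le> (2 * pi * B) * \<bar>\<xi> - \<xi>'\<bar>"
          using elim by (intro mult_right_mono mult_left_mono B) auto
        finally show ?case .
      qed
    qed (use D in auto)
    also have "\<dots> = (2 * pi * B * measure \<nu> UNIV) * \<bar>\<xi> - \<xi>'\<bar>" by simp
    finally show ?thesis .
  qed
  with B0 show ?thesis by (intro that[of "2 * pi * B * measure \<nu> UNIV"]) simp_all
qed

text \<open>Reversing the frequency conjugates the integrand; this reduces negative frequencies to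
  positive ones.\<close>

lemma cmod_image_transform_minus: "cmod (image_transform \<omega> (- \<xi>)) = cmod (image_transform \<omega> \<xi>)"
proof -
  have "image_transform \<omega> (- \<xi>) = (LINT u|\<nu>. cnj (cis (- 2 * pi * \<xi> * W (max 0 u) \<omega>)))"
    unfolding image_transform_def by (simp add: cis_cnj)
  also have "\<dots> = cnj (image_transform \<omega> \<xi>)"
    unfolding image_transform_def by (rule Bochner_Integration.integral_cnj)
  finally show ?thesis by simp
qed

end

lemma AE_image_transform_decay:
  "AE \<omega> in M. \<exists>C. \<forall>\<xi>. \<bar>\<xi>\<bar> \<ge> 2 \<longrightarrow> cmod (image_transform \<omega> \<xi>) \<le> C * \<bar>\<xi>\<bar> powr (- s) * ln \<bar>\<xi>\<bar>"
  using AE_truncated_transform_bound continuous_paths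
proof eventually_elim
  case (elim \<omega>)
  note path = elim(2)
  obtain C where C: "0 \<le> C"
    "\<And>k. cmod (truncated_transform (sample_point k) \<omega>)
      \<le> C * sample_point k powr (- s) * (1 + ln (sample_point k))"
    using elim(1) by blast
  obtain L where L: "0 \<le> L"
    "\<And>\<xi> \<xi>'. cmod (image_transform \<omega> \<xi> - image_transform \<omega> \<xi>') \<le> L * \<bar>\<xi> - \<xi>'\<bar>"
    by (rule image_transform_lipschitz[OF path]) blast
  have samples: "cmod (image_transform \<omega> (sample_point k))
      \<le> (C + K) * sample_point k powr (- s) * (1 + ln (sample_point k))" for k
  proof -
    define r where "r = sample_point k"
    have r: "1 \<le> r" unfolding r_def by (rule sample_point_ge_1)
    have "cmod (image_transform \<omega> r) \<le> cmod (truncated_transform r \<omega>)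
        + cmod (image_transform \<omega> r - truncated_transform r \<omega>)"
      by (rule norm_triangle_sub)
    also have "\<dots> \<le> C * r powr (- s) * (1 + ln r) + K * r powr (- s)"
      using r unfolding r_def by (intro add_mono C image_transform_truncation_error[OF path]) auto
    also have "K * r powr (- s) \<le> K * r powr (- s) * (1 + ln r)"
      using mult_left_mono[of 1 "1 + ln r" "K * r powr (- s)"] r mass.K_nonneg by simp
    \<comment> \<open>The truncation error is absorbed through \<open>1 \<le> 1 + ln r\<close>,
      which replaces \<open>C\<close> by \<open>C + K\<close>.\<close>
    finally show ?thesis unfolding r_def by (simp add: algebra_simps)
  qed
  define C' where "C' = (3 * (C + K) + 2 * L) * 2 powr s"
  have pos: "cmod (image_transform \<omega> \<xi>) \<le> C' * \<xi> powr (- s) * ln \<xi>" if "2 \<le> \<xi>" for \<xi>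
    unfolding C'_def using C L mass.K_nonneg mass.s_pos samples[unfolded sample_point_def] that
    by (intro decay_of_decay_at_samples) auto
  show ?case
  proof (intro exI[of _ C'] allI impI)
    fix \<xi> :: real assume "2 \<le> \<bar>\<xi>\<bar>"
    then have "cmod (image_transform \<omega> \<bar>\<xi>\<bar>) \<le> C' * \<bar>\<xi>\<bar> powr (- s) * ln \<bar>\<xi>\<bar>" by (rule pos)
    moreover have "cmod (image_transform \<omega> \<bar>\<xi>\<bar>) = cmod (image_transform \<omega> \<xi>)"
      using cmod_image_transform_minus[OF path, of \<xi>] by (simp add: abs_if)
    ultimately show "cmod (image_transform \<omega> \<xi>) \<le> C' * \<bar>\<xi>\<bar> powr (- s) * ln \<bar>\<xi>\<bar>" by simp
  qed
qed

end

section \<open>From bounds on the support to bounds at every positive point\<close>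

lemma first_mass_point:
  fixes M :: "real measure"
  assumes "finite_measure M" and borel: "sets M = sets borel" and pos: "0 < measure M {x..z}"
  obtains x' where "x \<le> x'" "measure M {x..<x'} = 0" "\<And>\<epsilon>. 0 < \<epsilon> \<Longrightarrow> 0 < measure M {x'..x' + \<epsilon>}"
proof -
  interpret finite_measure M by fact
  note [measurable_cong, simp] = borel
  \<comment> \<open>The infimum of the right ends at which mass has appeared is the first point,
    from \<open>x\<close> on, whose right neighbourhoods all have positive mass.\<close>
  define S where "S = {y. 0 < measure M {x..y}}"
  have zS: "z \<in> S" using pos by (simp add: S_def)
  have lower: "x \<le> y" if "y \<in> S" for y
  proof (rule ccontr)
    assume "\<not> x \<le> y"
    then have "{x..y} = {}" by simp
    then show False using that by (simp add: S_def)
  qed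
  then have bdd: "bdd_below S" by (rule bdd_belowI)
  define x' where "x' = Inf S"
  have xx': "x \<le> x'" unfolding x'_def using zS lower by (intro cInf_greatest) auto
  have null: "measure M {x..<x'} = 0"
  proof -
    \<comment> \<open>Every closed interval ending before the infimum is null, and countably many of
      them exhaust the half-open one.\<close>
    have "{x..<x'} = (\<Union>n. {x..x' - 1 / real (Suc n)})"
    proof (intro equalityI subsetI)
      fix y assume y: "y \<in> {x..<x'}"
      then obtain n where "1 / real (Suc n) < x' - y" using nat_approx_posE[of "x' - y"] by auto
      then show "y \<in> (\<Union>n. {x..x' - 1 / real (Suc n)})" using y by (auto intro!: exI[of _ n])
    next
      fix y assume "y \<in> (\<Union>n. {x..x' - 1 / real (Suc n)})"
      then obtain n where "x \<le> y" "y \<le> x' - 1 / real (Suc n)" by auto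
      moreover have "x' - 1 / real (Suc n) < x'" by simp
      ultimately have "x \<le> y" "y < x'" by (blast intro: le_less_trans)+
      then show "y \<in> {x..<x'}" by simp
    qed
    moreover have "emeasure M {x..x' - 1 / real (Suc n)} = 0" for n
    proof -
      have "x' - 1 / real (Suc n) < x'" by simp
      then have "x' - 1 / real (Suc n) \<notin> S"
        using cInf_lower[OF _ bdd] unfolding x'_def by fastforce
      then have "measure M {x..x' - 1 / real (Suc n)} = 0"
        using measure_nonneg[of M] by (simp add: S_def order.antisym not_less)
      then show ?thesis by (simp add: emeasure_eq_measure)
    qed
    ultimately have "emeasure M {x..<x'} = 0"
      by (auto intro!: emeasure_UN_eq_0)
    then show ?thesis by (simp add: measure_def)
  qed
  have "0 < measure M {x'..x' + \<epsilon>}" if "0 < \<epsilon>" for \<epsilon>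
  proof -
    have "S \<noteq> {}" using zS by blast
    moreover have "Inf S < x' + \<epsilon>" using that by (simp add: x'_def)
    ultimately obtain y where y: "y \<in> S" "y < x' + \<epsilon>" using cInf_lessD by blast
    have "0 < measure M {x..y}" using y by (simp add: S_def)
    also have "\<dots> \<le> measure M ({x..<x'} \<union> {x'..x' + \<epsilon>})"
      using y by (intro finite_measure_mono) auto
    also have "\<dots> \<le> measure M {x..<x'} + measure M {x'..x' + \<epsilon>}"
      by (rule measure_Un_le) auto
    finally show ?thesis using null by simp
  qed
  with xx' null show ?thesis by (rule that)
qed

lemma space_of_restricted_borel:
  "sets \<mu> = sets (restrict_space borel A) \<Longrightarrow> space \<mu> = A"
  using sets_eq_imp_space_eq[of \<mu> "restrict_space borel A"] by (simp add: space_restrict_space)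

lemma id_measurable_restricted_borel:
  assumes "sets \<mu> = sets (restrict_space borel A)"
  shows "(\<lambda>x. x) \<in> \<mu> \<rightarrow>\<^sub>M borel"
proof -
  have "(\<lambda>x. x) \<in> restrict_space borel A \<rightarrow>\<^sub>M borel" by (rule measurable_restrict_space1) simp
  then show ?thesis using measurable_cong_sets[OF assms refl] by blast
qed

text \<open>If an interval starting at \<open>x\<close> has mass, its left end can be moved right to
  the first support point \<open>x'\<close> without losing any. The moved interval of the same
  length still covers what matters, and the bound only improves because the weight
  \<open>x powr (- s / 2)\<close> decreases in \<open>x\<close>. Intervals without mass are trivial,
  as \<open>K\<close> is nonnegative.\<close>

lemma frostman_measure_of_support_bound:
  assumes s: "0 < s" and "finite_measure \<mu>"
    and sets_\<mu>: "sets \<mu> = sets (restrict_space borel {0..1})"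
    and origin: "\<forall>r>0. measure \<mu> ({0..r} \<inter> {0..1}) \<le> K * r powr (s / 2)"
    and support: "\<forall>x \<in> measure_support \<mu> - {0}. \<forall>r>0.
           measure \<mu> ({x..x + r} \<inter> {0..1}) \<le> K * min 1 (x powr (- s / 2) * r powr s)"
  shows "frostman_measure (distr \<mu> borel (\<lambda>x. x)) s K"
proof -
  interpret \<mu>: finite_measure \<mu> by fact
  define \<nu> where "\<nu> = distr \<mu> borel (\<lambda>x. x :: real)"
  note space_\<mu> = space_of_restricted_borel[OF sets_\<mu>] and id_meas = id_measurable_restricted_borel[OF sets_\<mu>]
  interpret \<nu>: finite_measure \<nu> unfolding \<nu>_def by (rule \<mu>.finite_measure_distr[OF id_meas])
  have sets_\<nu>: "sets \<nu> = sets borel" by (simp add: \<nu>_def)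
  have em: "emeasure \<nu> A = emeasure \<mu> (A \<inter> {0..1})" if "A \<in> sets borel" for A
    unfolding \<nu>_def using that id_meas by (simp add: emeasure_distr space_\<mu> vimage_def Int_def)
  have me: "measure \<nu> A = measure \<mu> (A \<inter> {0..1})" if "A \<in> sets borel" for A
    using em[OF that] by (simp add: measure_def)
  have origin': "measure \<nu> {0..r} \<le> K * r powr (s / 2)" if "0 < r" for r
    using origin that by (simp add: me)
  then have K: "0 \<le> K" using order_trans[OF measure_nonneg origin'[of 1]] by simp
  have conc: "AE u in \<nu>. 0 \<le> u \<and> u \<le> 1"
    unfolding \<nu>_def by (subst AE_distr_iff[OF id_meas]) (auto intro!: AE_I2 simp: space_\<mu>)
  have interval: "measure \<nu> {x..x + r} \<le> K * x powr (- s / 2) * r powr s" if x: "0 < x" and r: "0 < r" for x r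
  proof (cases "0 < measure \<nu> {x..x + r}")
    case False
    then have "measure \<nu> {x..x + r} \<le> 0" by simp
    also have "0 \<le> K * x powr (- s / 2) * r powr s" using K by simp
    finally show ?thesis .
  next
    case True
    obtain x' where x': "x \<le> x'" "measure \<nu> {x..<x'} = 0" "\<And>\<epsilon>. 0 < \<epsilon> \<Longrightarrow> 0 < measure \<nu> {x'..x' + \<epsilon>}"
      by (rule first_mass_point[OF \<nu>.finite_measure_axioms sets_\<nu> True]) blast
    \<comment> \<open>Otherwise an interval disjoint from the unit interval would have positive
      mass.\<close>
    have "x' \<le> 1"
    proof (rule ccontr)
      assume "\<not> x' \<le> 1"
      then have "{x'..x' + 1} \<inter> {0..1} = {}" by auto
      then show False using x'(3)[of 1] by (simp add: me)
    qed
    have "x' \<in> measure_support \<mu>"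
      unfolding measure_support_def
    proof (intro CollectI conjI allI impI)
      show "x' \<in> space \<mu>" using \<open>x' \<le> 1\<close> x x' by (simp add: space_\<mu>)
      fix U :: "real set" assume U: "open U" "x' \<in> U"
      then obtain \<epsilon> where \<epsilon>: "0 < \<epsilon>" "cball x' \<epsilon> \<subseteq> U" using open_contains_cball by blast
      \<comment> \<open>One-sided neighbourhoods suffice: their positive mass already makes every
        open neighbourhood of \<open>x'\<close> charged.\<close>
      have "{x'..x' + \<epsilon>} \<subseteq> U" using \<epsilon> by (auto simp: cball_def dist_real_def)
      then have "measure \<nu> {x'..x' + \<epsilon>} \<le> measure \<nu> U"
        using U by (intro \<nu>.finite_measure_mono) (auto simp: sets_\<nu>)
      then have "0 < measure \<nu> U" using x'(3)[OF \<epsilon>(1)] by simp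
      then show "0 < emeasure \<mu> (U \<inter> space \<mu>)"
        using U em[of U, symmetric] by (simp add: space_\<mu> \<nu>.emeasure_eq_measure)
    qed
    then have "measure \<mu> ({x'..x' + r} \<inter> {0..1}) \<le> K * min 1 (x' powr (- s / 2) * r powr s)"
      using bspec[OF support, of x'] x x' r by (simp del: Int_atLeastAtMost)
    have "measure \<nu> {x..x + r} \<le> measure \<nu> ({x..<x'} \<union> {x'..x' + r})"
      using x' by (intro \<nu>.finite_measure_mono) (auto simp: sets_\<nu>)
    also have "\<dots> \<le> measure \<nu> {x..<x'} + measure \<nu> {x'..x' + r}"
      by (rule measure_Un_le) (auto simp: sets_\<nu>)
    also have "\<dots> = measure \<mu> ({x'..x' + r} \<inter> {0..1})" using x' by (simp add: me)
    also have "\<dots> \<le> K * min 1 (x' powr (- s / 2) * r powr s)" by fact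
    also have "\<dots> \<le> K * (x powr (- s / 2) * r powr s)"
    proof (rule mult_left_mono[OF _ K])
      have "x' powr (- s / 2) \<le> x powr (- s / 2)" using x x' s by (intro powr_mono2') auto
      then have "x' powr (- s / 2) * r powr s \<le> x powr (- s / 2) * r powr s"
        by (rule mult_right_mono) simp
      then show "min 1 (x' powr (- s / 2) * r powr s) \<le> x powr (- s / 2) * r powr s" by simp
    qed
    finally show ?thesis by (simp add: mult.assoc)
  qed
  show ?thesis
    unfolding \<nu>_def[symmetric] using sets_\<nu> conc s origin' interval
    by unfold_locales auto
qed

theorem theorem5p1:
  fixes s K :: real
    and \<mu> :: "real measure"
    and M :: "'w measure"
    and W :: "real \<Rightarrow> 'w \<Rightarrow> real"
  assumes "s > 0"
    and "finite_measure \<mu>"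
    and "sets \<mu> = sets (restrict_space borel {0..1})"
    and "\<forall>r>0. measure \<mu> ({0..r} \<inter> {0..1}) \<le> K * r powr (s / 2)"
    and "\<forall>x \<in> measure_support \<mu> - {0}. \<forall>r>0.
           measure \<mu> ({x..x + r} \<inter> {0..1}) \<le> K * min 1 (x powr (- s / 2) * r powr s)"
    and "brownian_motion M W"
  shows "AE \<omega> in M. \<exists>C::real. \<forall>\<xi>::real. \<bar>\<xi>\<bar> \<ge> 2 \<longrightarrow>
           cmod (fourier_transform (distr \<mu> borel (\<lambda>t. W t \<omega>)) \<xi>)
             \<le> C * \<bar>\<xi>\<bar> powr (- s) * ln \<bar>\<xi>\<bar>"
proof -
  define \<nu> where "\<nu> = distr \<mu> borel (\<lambda>x. x :: real)"
  interpret brownian_image M W \<nu> s K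
    unfolding \<nu>_def
    by (intro brownian_image.intro assms frostman_measure_of_support_bound)
  note space_\<mu> = space_of_restricted_borel[OF assms(3)] and id_meas = id_measurable_restricted_borel[OF assms(3)]
  have transform: "fourier_transform (distr \<mu> borel (\<lambda>t. W t \<omega>)) \<xi> = image_transform \<omega> \<xi>"
    if path: "continuous_on {0..} (\<lambda>t. W t \<omega>)" for \<omega> \<xi>
  proof -
    have cis_eq: "exp (- 2 * complex_of_real pi * \<i> * complex_of_real x * complex_of_real \<xi>)
        = cis (- 2 * pi * \<xi> * x)" for x
      by (simp add: cis_conv_exp mult_ac)
    \<comment> \<open>On the unit interval \<open>max 0 t = t\<close>. The modified path is Borel on
      the whole line, so the push-forward can be taken in two stages through \<nu>.\<close>
    have "distr \<mu> borel (\<lambda>t. W t \<omega>) = distr \<mu> borel (\<lambda>t. W (max 0 t) \<omega>)"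
      by (rule distr_cong) (auto simp: space_\<mu>)
    also have "\<dots> = distr \<nu> borel (\<lambda>t. W (max 0 t) \<omega>)"
      unfolding \<nu>_def
      by (subst distr_distr[OF borel_measurable_path[OF path] id_meas]) (simp add: comp_def)
    finally have "fourier_transform (distr \<mu> borel (\<lambda>t. W t \<omega>)) \<xi>
        = (LINT x|distr \<nu> borel (\<lambda>t. W (max 0 t) \<omega>). cis (- 2 * pi * \<xi> * x))"
      by (simp only: fourier_transform_def cis_eq)
    also have "\<dots> = image_transform \<omega> \<xi>"
      unfolding image_transform_def
    proof (rule integral_distr)
      show "(\<lambda>t. W (max 0 t) \<omega>) \<in> \<nu> \<rightarrow>\<^sub>M borel"
        using borel_measurable_path[OF path] by measurable
      show "(\<lambda>x. cis (- 2 * pi * \<xi> * x)) \<in> borel_measurable borel"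
        by (intro borel_measurable_continuous_onI continuous_intros)
    qed
    finally show ?thesis .
  qed
  show ?thesis
    using AE_image_transform_decay continuous_paths
    by eventually_elim (simp only: transform)
qed

end
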